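(* Let $r$ be a positive integer. Then: (i) $S_{r,2}$ is a well-indumatched tree; (ii) $G_r$ is a well-indumatched unicyclic graph of girth $3$; (iii) $H_r$ is a well-indumatched unicyclic graph of girth $5$; (iv) $L_r$ is a well-indumatched unicyclic graph of girth $7$; (v) for every even integer $k\geq 4$, $Q_{k,r}$ is a well-indumatched unicyclic graph of girth $k$. Consequently, there are infinitely many well-indumatched trees, and infinitely many well-indumatched unicyclic graphs of girth $k$ whenever $k\in\{3,5,7\}$ or $k$ is an even integer greater than $2$.
   Context: All graphs are finite, simple and undirected. An induced matching of a graph $G$ is a set $M$ of edges, no two sharing an endpoint, such that no edge of $G$ joins an endpoint of one edge of $M$ to an endpoint of another edge of $M$. A graph is well-indumatched if all of its inclusion-wise maximal induced matchings have the same size. A unicyclic graph is a connected graph with exactly one cycle; the girth is the length of a shortest cycle. For integers $r\geq 1$, $k\geq 0$, $S_{r,k}$ is the tree obtained from the star $K_{1,r}$ by subdividing each edge with $k$ new vertices; its center is the vertex corresponding to the center of $K_{1,r}$. $G_r$: take disjoint copies of the triangle $C_3$ and $S_{r,2}$, join the center of $S_{r,2}$ by an edge to one vertex of $C_3$, and add a new vertex joined to another vertex of $C_3$. $H_r$: take disjoint copies of $C_5$ and $S_{r,2}$ and identify the center of $S_{r,2}$ with a vertex of $C_5$. $L_r$: identify a vertex of $C_7$ with the center of $S_{r,3}$, and add a new vertex joined to one neighbor (on $C_7$) of the identified vertex. $Q_{k,r}$ (for even $k\geq 4$): take a cycle $C_k$ with vertices $v_1,\dots,v_k$ in cyclic order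 and a disjoint copy of $S_{r,2}$, identify the center of $S_{r,2}$ with $v_1$, and for each of $v_2,v_4,\dots,v_k$ add a new copy of the path $P_2$ (one edge) and join one of its endpoints to that vertex. *)

theory Defs
  imports "Graph_Theory.Graph_Theory" "HOL-Library.Extended_Nat"
begin

text \<open>
  A finite simple undirected graph is a \<^const>\<open>pair_graph\<close>: every undirected edge is
  represented by its two arcs. An undirected edge itself is the two-element set of its endpoints.
\<close>

definition edges :: "'a pair_pre_digraph \<Rightarrow> 'a set set" where
  "edges G = {{u, v} | u v. (u, v) \<in> parcs G}"

definition induced_matching :: "'a pair_pre_digraph \<Rightarrow> 'a set set \<Rightarrow> bool" where
  "induced_matching G M \<longleftrightarrow> M \<subseteq> edges G \<and>
    (\<forall>e\<in>M. \<forall>f\<in>M. e \<noteq> f \<longrightarrow> e \<inter> f = {} \<and> (\<forall>u\<in>e. \<forall>v\<in>f. {u, v} \<notin> edges G))"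

definition maximal_induced_matching :: "'a pair_pre_digraph \<Rightarrow> 'a set set \<Rightarrow> bool" where
  "maximal_induced_matching G M \<longleftrightarrow>
    induced_matching G M \<and> (\<forall>N. induced_matching G N \<and> M \<subseteq> N \<longrightarrow> N = M)"

definition well_indumatched :: "'a pair_pre_digraph \<Rightarrow> bool" where
  "well_indumatched G \<longleftrightarrow> pair_graph G \<and>
    (\<forall>M N. maximal_induced_matching G M \<and> maximal_induced_matching G N \<longrightarrow> card M = card N)"

text \<open>
  The library's \<^const>\<open>pre_digraph.cycle\<close> also accepts the closed walk of length 2 that runs
  along an edge and back, and it distinguishes starting points and orientations. A cycle of an
  undirected graph is therefore the set of edges of such a closed walk of length at least 3.
  For the same reason the library's notions of forest and tree are not the undirected ones.
\<close>

definition ucycles :: "'a pair_pre_digraph \<Rightarrow> 'a set set set" where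
  "ucycles G = {(\<lambda>(u, v). {u, v}) ` set p | p. pre_digraph.cycle (with_proj G) p \<and> 3 \<le> length p}"

definition undirected_tree :: "'a pair_pre_digraph \<Rightarrow> bool" where
  "undirected_tree G \<longleftrightarrow>
    pair_graph G \<and> Digraph_Component.connected (with_proj G) \<and> ucycles G = {}"

definition unicyclic :: "'a pair_pre_digraph \<Rightarrow> bool" where
  "unicyclic G \<longleftrightarrow>
    pair_graph G \<and> Digraph_Component.connected (with_proj G) \<and> (\<exists>!C. C \<in> ucycles G)"

text \<open>The girth of an acyclic graph is infinite.\<close>

definition girth :: "'a pair_pre_digraph \<Rightarrow> enat" where
  "girth G = (INF C\<in>ucycles G. enat (card C))"

text \<open>
  Vertices: \<open>Leg i j\<close> is the \<open>j\<close>-th vertex, counted from the center, on the \<open>i\<close>-th leg of a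
  subdivided star; \<open>Cyc i\<close> is the cycle vertex \<open>v\<^sub>i\<close>, indexed from 1; \<open>Pend i j\<close> is the
  \<open>j\<close>-th vertex of a path attached to \<open>v\<^sub>i\<close>; \<open>Center\<close> is the center of a subdivided star whose
  center is not identified with a cycle vertex.
\<close>

datatype vertex = Center | Leg nat nat | Cyc nat | Pend nat nat

text \<open>
  A graph is given by listing each edge in one direction. No graph below has isolated vertices
  (for \<open>r \<ge> 1\<close>), so its vertices are the endpoints of its edges.
\<close>

definition graph_of :: "'a rel \<Rightarrow> 'a pair_pre_digraph" where
  "graph_of R = \<lparr>pverts = Field R, parcs = R \<union> R\<inverse>\<rparr>"

text \<open>
  The star \<open>K\<^bsub>1,r\<^esub>\<close> with center \<open>c\<close>, every edge subdivided by \<open>k\<close> new vertices: the leg \<open>i\<close>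
  consists of the subdivision vertices \<open>Leg i 1, \<dots>, Leg i k\<close> and the leaf \<open>Leg i (Suc k)\<close>.
  Taking a cycle vertex for \<open>c\<close> amounts to identifying the center with that vertex.
\<close>

definition spider_links :: "vertex \<Rightarrow> nat \<Rightarrow> nat \<Rightarrow> vertex rel" where
  "spider_links c r k = {(c, Leg i 1) | i. i < r} \<union>
    {(Leg i j, Leg i (Suc j)) | i j. i < r \<and> 1 \<le> j \<and> j \<le> k}"

definition cycle_links :: "nat \<Rightarrow> vertex rel" where
  "cycle_links n = {(Cyc i, Cyc (Suc i)) | i. 1 \<le> i \<and> i < n} \<union> {(Cyc n, Cyc 1)}"

definition S_graph :: "nat \<Rightarrow> nat \<Rightarrow> vertex pair_pre_digraph" where
  "S_graph r k = graph_of (spider_links Center r k)"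

definition G_graph :: "nat \<Rightarrow> vertex pair_pre_digraph" where
  "G_graph r = graph_of (cycle_links 3 \<union> spider_links Center r 2 \<union>
    {(Center, Cyc 1), (Cyc 2, Pend 2 1)})"

definition H_graph :: "nat \<Rightarrow> vertex pair_pre_digraph" where
  "H_graph r = graph_of (cycle_links 5 \<union> spider_links (Cyc 1) r 2)"

definition L_graph :: "nat \<Rightarrow> vertex pair_pre_digraph" where
  "L_graph r = graph_of (cycle_links 7 \<union> spider_links (Cyc 1) r 3 \<union> {(Cyc 2, Pend 2 1)})"

definition Q_graph :: "nat \<Rightarrow> nat \<Rightarrow> vertex pair_pre_digraph" where
  "Q_graph k r = graph_of (cycle_links k \<union> spider_links (Cyc 1) r 2 \<union>
    (\<Union>i\<in>{i. even i \<and> 2 \<le> i \<and> i \<le> k}. {(Cyc i, Pend i 1), (Pend i 1, Pend i 2)}))"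

text \<open>
  Every finite graph is isomorphic to one with vertices in \<^typ>\<open>nat\<close>, so the equivalence
  classes of this relation are the isomorphism classes of finite graphs.
\<close>

definition graph_iso_rel :: "nat pair_pre_digraph rel" where
  "graph_iso_rel =
    {(G, H). pair_graph G \<and> pair_graph H \<and> digraph_iso (with_proj G) (with_proj H)}"

lemma equiv_graph_iso_rel: "equiv (Collect pair_graph) graph_iso_rel"
proof (rule equivI)
  show "graph_iso_rel \<subseteq> Collect pair_graph \<times> Collect pair_graph"
    by (auto simp: graph_iso_rel_def)
  show "refl_on (Collect pair_graph) graph_iso_rel"
  proof (rule refl_onI)
    fix G :: "nat pair_pre_digraph" assume "G \<in> Collect pair_graph"
    then interpret pair_graph G by simp
    let ?f = "\<lparr>iso_verts = id, iso_arcs = id, iso_head = snd, iso_tail = fst\<rparr>"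
    have "digraph_isomorphism ?f"
      unfolding digraph_isomorphism_def using wf_digraph by simp
    moreover have "with_proj G = app_iso ?f (with_proj G)"
      by (simp add: app_iso_def with_proj_def)
    ultimately show "(G, G) \<in> graph_iso_rel"
      using pair_graph by (auto simp: graph_iso_rel_def digraph_iso_def)
  qed
  show "sym graph_iso_rel"
  proof (rule symI)
    fix G H assume GH: "(G, H) \<in> graph_iso_rel"
    then interpret pair_graph G by (simp add: graph_iso_rel_def)
    show "(H, G) \<in> graph_iso_rel"
      using GH digraph_iso_swap[OF wf_digraph] by (auto simp: graph_iso_rel_def)
  qed
  show "trans graph_iso_rel"
    by (auto simp: graph_iso_rel_def trans_def intro: digraph_iso_trans)
qed

end

theory Submission
  imports Defs "HOL-Library.Countable"
begin

text \<open>
  Call two edges conflicting if no induced matching contains both. Suppose the edge set is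
  partitioned into blocks of pairwise conflicting edges, each containing an edge that conflicts with
  no edge outside its block. Then every maximal induced matching has exactly one edge in every block,
  so its size is the number of blocks. The legs of the spiders are such blocks, and the remaining
  edges of \<open>G\<^sub>r\<close> and of \<open>H\<^sub>r\<close> form one further block, those of \<open>Q\<^bsub>k,r\<^esub>\<close> one block for each attached
  path. In \<open>L\<^sub>r\<close>, the outer three edges of each leg form a block, and every maximal induced matching
  contains exactly two of the remaining edges.

  On a cycle every vertex has two different neighbours, so a cycle cannot enter the trees attached to
  the cycle \<open>v\<^sub>1, \<dots>, v\<^sub>n\<close>. The vertex counts of the graphs are unbounded in \<open>r\<close>, whence infinitely
  many isomorphism classes.
\<close>

section \<open>Blocks of conflicting edges\<close>

abbreviation edge_of :: "'a \<times> 'a \<Rightarrow> 'a set" where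
  "edge_of p \<equiv> {fst p, snd p}"

lemma edges_graph_of: "edges (graph_of R) = edge_of ` R"
proof -
  have "edges (graph_of R) = {{u, v} | u v. (u, v) \<in> R}"
    unfolding edges_def graph_of_def by (auto simp: insert_commute)
  then show ?thesis
    by (auto simp: image_def) (metis fst_conv snd_conv)
qed

lemma doubleton_in_edges_graph_of: "{u, v} \<in> edges (graph_of R) \<longleftrightarrow> (u, v) \<in> R \<or> (v, u) \<in> R"
  unfolding edges_def graph_of_def by (auto simp: doubleton_eq_iff)

text \<open>A loop is its own converse, so disjointness of \<open>R\<close> from
  \<open>R\<inverse>\<close> excludes loops.\<close>

lemma pair_graph_graph_of:
  assumes "finite R" "R \<inter> R\<inverse> = {}"
  shows "pair_graph (graph_of R)"
proof
  fix e assume "e \<in> parcs (graph_of R)"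
  then show "fst e \<in> pverts (graph_of R)" "snd e \<in> pverts (graph_of R)" "fst e \<noteq> snd e"
    using assms(2) by (cases e; auto simp: graph_of_def Field_def)+
next
  show "finite (pverts (graph_of R))" "finite (parcs (graph_of R))"
    using assms(1) by (auto simp: graph_of_def finite_Field)
next
  show "symmetric (graph_of R)"
    by (auto simp: symmetric_def graph_of_def sym_def)
qed

text \<open>A pair stands for the edge between its components; \<open>R\<close> lists every edge in one direction.\<close>

definition conflict :: "'a rel \<Rightarrow> 'a \<times> 'a \<Rightarrow> 'a \<times> 'a \<Rightarrow> bool" where
  "conflict R p q \<longleftrightarrow> (\<exists>u\<in>edge_of p. \<exists>v\<in>edge_of q. u = v \<or> (u, v) \<in> R \<or> (v, u) \<in> R)"

text \<open>Maximal independent sets of the conflict graph on \<open>R\<close>. Every pair conflicts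
  with itself, hence the guard \<open>p \<noteq> q\<close>.\<close>

definition maximal_conflict_free :: "'a rel \<Rightarrow> 'a rel \<Rightarrow> bool" where
  "maximal_conflict_free R A \<longleftrightarrow> A \<subseteq> R \<and> (\<forall>p\<in>A. \<forall>q\<in>A. p \<noteq> q \<longrightarrow> \<not> conflict R p q) \<and>
     (\<forall>p\<in>R - A. \<exists>q\<in>A. conflict R p q)"

lemma conflict_commute: "conflict R p q \<longleftrightarrow> conflict R q p"
  unfolding conflict_def by blast

lemma inj_on_edge_of:
  assumes "R \<inter> R\<inverse> = {}"
  shows "inj_on edge_of R"
proof (rule inj_onI)
  fix p q assume "p \<in> R" "q \<in> R" "edge_of p = edge_of q"
  then show "p = q"
    using assms by (cases p; cases q) (auto simp: doubleton_eq_iff)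
qed

text \<open>Sharing an endpoint and being joined by an edge are the two ways to be in conflict;
  injectivity of \<open>edge_of\<close> on \<open>R\<close> matches distinct pairs with distinct
  edges.\<close>

lemma induced_matching_graph_of:
  assumes "R \<inter> R\<inverse> = {}" "A \<subseteq> R"
  shows "induced_matching (graph_of R) (edge_of ` A) \<longleftrightarrow>
    (\<forall>p\<in>A. \<forall>q\<in>A. p \<noteq> q \<longrightarrow> \<not> conflict R p q)"
proof -
  have ne: "edge_of p \<noteq> edge_of q \<longleftrightarrow> p \<noteq> q" if "p \<in> A" "q \<in> A" for p q
    using that inj_on_edge_of[OF assms(1)] assms(2) by (meson inj_onD subsetD)
  have "(edge_of p \<inter> edge_of q = {} \<and>
      (\<forall>u\<in>edge_of p. \<forall>v\<in>edge_of q. {u, v} \<notin> edges (graph_of R))) \<longleftrightarrow> \<not> conflict R p q" for p q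
    unfolding conflict_def doubleton_in_edges_graph_of by blast
  moreover have "edge_of ` A \<subseteq> edges (graph_of R)"
    using assms(2) by (auto simp: edges_graph_of)
  ultimately show ?thesis
    unfolding induced_matching_def by (simp add: ne ball_simps)
qed

lemma maximal_induced_matching_graph_ofE:
  assumes asym: "R \<inter> R\<inverse> = {}" and M: "maximal_induced_matching (graph_of R) M"
  obtains A where "maximal_conflict_free R A" "card M = card A"
proof -
  have ind: "induced_matching (graph_of R) M"
    and max: "\<And>N. induced_matching (graph_of R) N \<Longrightarrow> M \<subseteq> N \<Longrightarrow> N = M"
    using M by (auto simp: maximal_induced_matching_def)
  then have "M \<subseteq> edge_of ` R"
    by (simp add: induced_matching_def edges_graph_of)
  then obtain A where A: "A \<subseteq> R" "M = edge_of ` A"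
    by (auto simp: subset_image_iff)
  have inj: "inj_on edge_of R"
    using asym by (rule inj_on_edge_of)
  have free: "\<not> conflict R p q" if "p \<in> A" "q \<in> A" "p \<noteq> q" for p q
    using ind that unfolding A(2) induced_matching_graph_of[OF asym A(1)] by blast
  have "\<exists>q\<in>A. conflict R p q" if p: "p \<in> R - A" for p
  proof (rule ccontr)
    assume no: "\<not> (\<exists>q\<in>A. conflict R p q)"
    have "insert p A \<subseteq> R"
      using p A(1) by blast
    then have "induced_matching (graph_of R) (edge_of ` insert p A)"
      unfolding induced_matching_graph_of[OF asym \<open>insert p A \<subseteq> R\<close>]
      using free no conflict_commute by blast
    \<comment> \<open>Maximality absorbs the new edge, while injectivity keeps it outside the image
      of \<open>A\<close>.\<close>
    then have "edge_of ` insert p A = edge_of ` A"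
      using max A(2) by blast
    then have "edge_of p \<in> edge_of ` A"
      by blast
    then show False
      using p A(1) inj_on_image_mem_iff[OF inj] by blast
  qed
  then have "maximal_conflict_free R A"
    using A(1) free by (auto simp: maximal_conflict_free_def)
  moreover have "card M = card A"
    unfolding A(2) using inj A(1) by (meson card_image inj_on_subset)
  ultimately show thesis
    by (rule that)
qed

lemma well_indumatched_graph_ofI:
  assumes "finite R" "R \<inter> R\<inverse> = {}"
    and "\<And>A. maximal_conflict_free R A \<Longrightarrow> card A = n"
  shows "well_indumatched (graph_of R)"
proof -
  have "card M = n" if "maximal_induced_matching (graph_of R) M" for M
    using maximal_induced_matching_graph_ofE[OF assms(2) that] assms(3) by metis
  then show ?thesis
    using pair_graph_graph_of[OF assms(1,2)] by (simp add: well_indumatched_def)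
qed

text \<open>In the conflict graph, \<open>s\<close> is a simplicial vertex: \<open>B\<close> is
  exactly its closed neighbourhood, and it is a clique.\<close>

definition simplicial_block :: "'a rel \<Rightarrow> 'a \<times> 'a \<Rightarrow> 'a rel \<Rightarrow> bool" where
  "simplicial_block R s B \<longleftrightarrow> s \<in> B \<and> B \<subseteq> R \<and> (\<forall>p\<in>R. conflict R p s \<longrightarrow> p \<in> B) \<and>
     (\<forall>p\<in>B. \<forall>q\<in>B. conflict R p q)"

text \<open>A maximal independent set contains \<open>s\<close> or one of its neighbours, all of
  which lie in \<open>B\<close>, and the clique \<open>B\<close> admits only one element.\<close>

lemma card_inter_simplicial_block:
  assumes A: "maximal_conflict_free R A" and B: "simplicial_block R s B"
  shows "card (A \<inter> B) = 1"
proof -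
  have "\<exists>q\<in>A. q \<in> B"
  proof (cases "s \<in> A")
    case True
    then show ?thesis using B by (auto simp: simplicial_block_def)
  next
    case False
    then obtain q where "q \<in> A" "conflict R s q"
      using A B unfolding maximal_conflict_free_def simplicial_block_def by blast
    then have "conflict R q s"
      by (simp add: conflict_commute)
    then show ?thesis
      using \<open>q \<in> A\<close> A B unfolding maximal_conflict_free_def simplicial_block_def by blast
  qed
  then obtain q where q: "q \<in> A \<inter> B" by blast
  have "A \<inter> B = {q}"
    using q A B unfolding maximal_conflict_free_def simplicial_block_def by blast
  then show ?thesis by simp
qed

lemma card_eq_sum_blocks:
  assumes "finite A" "finite I" "lab ` A \<subseteq> I"
  shows "card A = (\<Sum>i\<in>I. card {p \<in> A. lab p = i})"
proof -
  have "A = (\<Union>i\<in>I. {p \<in> A. lab p = i})" using assms(3) by auto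
  then have "card A = card (\<Union>i\<in>I. {p \<in> A. lab p = i})" by simp
  also have "\<dots> = (\<Sum>i\<in>I. card {p \<in> A. lab p = i})"
    by (rule card_UN_disjoint) (use assms in auto)
  finally show ?thesis .
qed

text \<open>The fibres of \<open>lab\<close> are the blocks, so every maximal conflict-free set has
  as many elements as there are labels.\<close>

lemma well_indumatched_if_simplicial_blocks:
  assumes fin: "finite R" and asym: "R \<inter> R\<inverse> = {}"
    and s: "\<And>i. i \<in> lab ` R \<Longrightarrow> simplicial_block R (s i) {p \<in> R. lab p = i}"
  shows "well_indumatched (graph_of R)"
proof (rule well_indumatched_graph_ofI[OF fin asym])
  fix A assume A: "maximal_conflict_free R A"
  then have sub: "A \<subseteq> R" by (simp add: maximal_conflict_free_def)
  have "card {p \<in> A. lab p = i} = 1" if "i \<in> lab ` R" for i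
  proof -
    have "{p \<in> A. lab p = i} = A \<inter> {p \<in> R. lab p = i}" using sub by auto
    then show ?thesis using card_inter_simplicial_block[OF A s[OF that]] by simp
  qed
  then show "card A = card (lab ` R)"
    using card_eq_sum_blocks[of A "lab ` R" lab] fin sub finite_subset[OF sub fin] by auto
qed


section \<open>Connectedness and cycles\<close>

text \<open>Arcs come in both directions, so connectedness and strong connectedness agree.\<close>

lemma connected_pair_graph_iff:
  assumes "pair_graph G"
  shows "Digraph_Component.connected (with_proj G) \<longleftrightarrow>
    pverts G \<noteq> {} \<and> (\<forall>u\<in>pverts G. \<forall>v\<in>pverts G. (u, v) \<in> (parcs G)\<^sup>*)"
proof -
  interpret pair_graph G by fact
  have "Digraph_Component.connected (with_proj G) \<longleftrightarrow> strongly_connected (with_proj G)"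
    using symmetric_connected_imp_strongly_connected[OF pair_sym_arcs]
    by (auto simp: connected_def strongly_connected_def reachable_mk_symmetric_eq[OF pair_sym_arcs])
  then show ?thesis
    unfolding strongly_connected_def by (auto simp: reachable_conv)
qed

text \<open>Any two vertices are joined through \<open>c\<close>: backwards along the links to
  \<open>c\<close>, then forwards. A head is one link further than its tail, so \<open>reach\<close>
  concerns tails only; the link from \<open>c\<close> makes the vertex set nonempty.\<close>

lemma connected_graph_ofI:
  assumes "finite R" "R \<inter> R\<inverse> = {}" and c: "(c, d) \<in> R"
    and reach: "\<And>u v. (u, v) \<in> R \<Longrightarrow> (c, u) \<in> R\<^sup>*"
  shows "Digraph_Component.connected (with_proj (graph_of R))"
proof -
  have r: "(c, v) \<in> R\<^sup>*" if "v \<in> Field R" for v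
    using that reach by (auto simp: Field_def intro: rtrancl_into_rtrancl)
  have "(u, v) \<in> (R \<union> R\<inverse>)\<^sup>*" if "u \<in> Field R" "v \<in> Field R" for u v
  proof -
    have "(u, c) \<in> (R\<inverse>)\<^sup>*" using r[OF that(1)] by (simp add: rtrancl_converse)
    then have "(u, c) \<in> (R \<union> R\<inverse>)\<^sup>*" by (meson Un_upper2 rtrancl_mono subsetD)
    moreover have "(c, v) \<in> (R \<union> R\<inverse>)\<^sup>*" using r[OF that(2)] by (meson Un_upper1 rtrancl_mono subsetD)
    ultimately show ?thesis by (rule rtrancl_trans)
  qed
  moreover have "Field R \<noteq> {}" using c by (auto simp: Field_def)
  ultimately show ?thesis
    by (simp add: connected_pair_graph_iff pair_graph_graph_of[OF assms(1,2)]) (simp add: graph_of_def)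
qed

lemma pcas_iff_nth:
  assumes "p \<noteq> []"
  shows "pcas u p v \<longleftrightarrow> fst (p ! 0) = u \<and> snd (p ! (length p - 1)) = v \<and>
    (\<forall>i. Suc i < length p \<longrightarrow> fst (p ! Suc i) = snd (p ! i))"
  using assms
proof (induction p arbitrary: u)
  case (Cons e p)
  show ?case
  proof (cases "p = []")
    case False
    have "(\<forall>i. Suc i < length (e # p) \<longrightarrow> fst ((e # p) ! Suc i) = snd ((e # p) ! i)) \<longleftrightarrow>
      fst (p ! 0) = snd e \<and> (\<forall>i. Suc i < length p \<longrightarrow> fst (p ! Suc i) = snd (p ! i))"
      (is "?l \<longleftrightarrow> ?r")
    proof
      assume l: ?l
      have "fst (p ! 0) = snd e" using l[rule_format, of 0] False by simp
      moreover have "fst (p ! Suc i) = snd (p ! i)" if "Suc i < length p" for i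
        using l[rule_format, of "Suc i"] that by simp
      ultimately show ?r by blast
    next
      assume ?r
      then show ?l by (auto simp: nth_Cons split: nat.split)
    qed
    moreover have "(e # p) ! (length (e # p) - 1) = p ! (length p - 1)"
      using False by (cases p) auto
    ultimately show ?thesis using Cons.IH[OF False, of "snd e"] by (auto simp del: nth_Cons_Suc)
  qed auto
qed simp

text \<open>The vertex list of a walk without its first entry is the list of arc heads, so repeating
  no vertex becomes distinctness of \<open>map snd p\<close>. The positional form suits index
  arithmetic.\<close>

lemma cycle_with_proj_iff:
  "pre_digraph.cycle (with_proj G) p \<longleftrightarrow> p \<noteq> [] \<and> set p \<subseteq> parcs G \<and> fst (p ! 0) \<in> pverts G \<and>
    distinct (map snd p) \<and> snd (p ! (length p - 1)) = fst (p ! 0) \<and>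
    (\<forall>i. Suc i < length p \<longrightarrow> fst (p ! Suc i) = snd (p ! i))"
proof -
  have "tl (pawalk_verts u p) = map snd p" if "p \<noteq> []" "pcas u p v" for u v
  proof -
    have "pawalk_verts w q = w # map snd q" if "pcas w q v" for w q
      using that by (induction q arbitrary: w) auto
    from this[OF that(2)] show ?thesis by simp
  qed
  then show ?thesis
    unfolding pre_digraph.cycle_def pre_digraph.awalk_def cas_with_proj_eq awalk_verts_with_proj_eq
    by (auto simp: pcas_iff_nth)
qed

lemma ucyclesI:
  "pre_digraph.cycle (with_proj G) p \<Longrightarrow> 3 \<le> length p \<Longrightarrow> edge_of ` set p \<in> ucycles G"
  unfolding ucycles_def case_prod_beta by blast

text \<open>Indices modulo \<open>n\<close> treat the closing step like all others.\<close>

lemma ucycleE: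
  assumes "C \<in> ucycles G"
  obtains p n where "C = edge_of ` set p" "n = length p" "3 \<le> n" "set p \<subseteq> parcs G"
    "distinct (map snd p)" "\<And>i. i < n \<Longrightarrow> fst (p ! (Suc i mod n)) = snd (p ! i)"
proof -
  obtain p where p: "C = edge_of ` set p" "3 \<le> length p" "pre_digraph.cycle (with_proj G) p"
    using assms by (auto simp: ucycles_def case_prod_beta)
  have "fst (p ! (Suc i mod length p)) = snd (p ! i)" if "i < length p" for i
  proof (cases "Suc i = length p")
    case True
    then have "i = length p - 1" by simp
    then show ?thesis using p(3) True by (simp add: cycle_with_proj_iff)
  next
    case False
    then show ?thesis using p(3) that by (simp add: cycle_with_proj_iff)
  qed
  then show thesis using p by (intro that[of p "length p"]) (auto simp: cycle_with_proj_iff)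
qed

lemma ucycle_subset_edges:
  assumes "C \<in> ucycles G"
  shows "C \<subseteq> edges G"
proof -
  obtain p where p: "C = edge_of ` set p" "set p \<subseteq> parcs G"
    using assms by (rule ucycleE)
  have "edge_of e \<in> edges G" if "e \<in> parcs G" for e
    using that by (cases e) (auto simp: edges_def)
  then show ?thesis
    using p by blast
qed

lemma ucycle_nonempty: "C \<in> ucycles G \<Longrightarrow> C \<noteq> {}"
  by (erule ucycleE) auto

lemma finite_ucycle: "C \<in> ucycles G \<Longrightarrow> finite C"
  by (erule ucycleE) auto

text \<open>The cyclic predecessor and successor of \<open>u\<close> differ because the walk has
  length at least 3 and repeats no head.\<close>

lemma ucycle_two_edges:
  assumes "C \<in> ucycles G" "u \<in> \<Union>C"
  obtains v w where "v \<noteq> w" "{u, v} \<in> C" "{u, w} \<in> C"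
proof -
  obtain p n where p: "C = edge_of ` set p" "n = length p" "3 \<le> n" "distinct (map snd p)"
    and suc: "\<And>i. i < n \<Longrightarrow> fst (p ! (Suc i mod n)) = snd (p ! i)"
    using assms(1) by (rule ucycleE) blast
  \<comment> \<open>Adding \<open>n - 1\<close> instead of subtracting 1 gives position 0 the right
    predecessor in the natural numbers.\<close>
  have pred: "fst (p ! i) = snd (p ! ((i + n - 1) mod n))" if "i < n" for i
  proof -
    have "Suc ((i + n - 1) mod n) mod n = i"
      using that p(3) by (simp add: mod_Suc_eq)
    then show ?thesis using suc[of "(i + n - 1) mod n"] p(3) by simp
  qed
  obtain i where i: "i < n" "u \<in> edge_of (p ! i)"
    using assms(2) p(1,2) by (auto simp: in_set_conv_nth)
  \<comment> \<open>Arc \<open>j\<close> enters \<open>u\<close>: if \<open>u\<close> is not the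
    head of arc \<open>i\<close>, it is its tail, hence the head of the arc before.\<close>
  obtain j where j: "j < n" "u = snd (p ! j)"
  proof (cases "u = snd (p ! i)")
    case False
    then show thesis using i pred[OF i(1)] p(3) by (intro that[of "(i + n - 1) mod n"]) auto
  qed (use i that in blast)
  define k where "k = Suc j mod n"
  have k: "k < n" using p(3) by (simp add: k_def)
  \<comment> \<open>For \<open>n = 2\<close> the position after \<open>j\<close> would also be the
    position before it.\<close>
  have "k \<noteq> (j + n - 1) mod n"
  proof
    assume eq: "k = (j + n - 1) mod n"
    show False
    proof (cases j)
      case 0
      then show False using eq p(3) by (simp add: k_def)
    next
      case (Suc m)
      then have "(j + n - 1) mod n = m" using j(1) by simp
      then show False using eq Suc j(1) p(3) by (cases "Suc j = n") (auto simp: k_def)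
    qed
  qed
  moreover have "(j + n - 1) mod n < n"
    using p(3) by simp
  ultimately have "snd (p ! k) \<noteq> fst (p ! j)"
    using p(2,4) k unfolding pred[OF j(1)] by (metis length_map nth_eq_iff_index_eq nth_map)
  moreover have "{u, fst (p ! j)} \<in> C"
    using j p(1,2) by (auto simp: insert_commute)
  moreover have "{u, snd (p ! k)} \<in> C"
    unfolding p(1) j(2) suc[OF j(1), symmetric] k_def[symmetric]
    using k p(2) by (intro imageI) auto
  ultimately show thesis using that by metis
qed

text \<open>Pruning: at a vertex of \<open>P\<close> of maximal height, a cycle would have to use the edge to the
  parent twice.\<close>

lemma ucycle_disjoint_branches:
  fixes h :: "'a \<Rightarrow> nat"
  assumes C: "C \<in> ucycles (graph_of R)"
    and P: "\<And>u v. u \<in> P \<Longrightarrow> (u, v) \<in> R \<union> R\<inverse> \<Longrightarrow> v = par u \<or> v \<in> P \<and> h u < h v"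
  shows "\<Union>C \<inter> P = {}"
proof (rule ccontr)
  assume ne: "\<Union>C \<inter> P \<noteq> {}"
  have adj: "(u, v) \<in> R \<union> R\<inverse>" if "{u, v} \<in> C" for u v
    using ucycle_subset_edges[OF C] that by (auto simp: doubleton_in_edges_graph_of)
  have "finite (\<Union>C)"
    using C ucycle_subset_edges[OF C] by (auto simp: finite_ucycle edges_graph_of)
  then have "finite (\<Union>C \<inter> P)" by blast
  then obtain u where u: "u \<in> \<Union>C \<inter> P" "\<And>v. v \<in> \<Union>C \<inter> P \<Longrightarrow> h v \<le> h u"
    using ne by (rule obtains_MAX[of _ h]) (metis Max_ge \<open>finite (\<Union>C \<inter> P)\<close> finite_imageI imageI)
  obtain v w where vw: "v \<noteq> w" "{u, v} \<in> C" "{u, w} \<in> C"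
    using u(1) ucycle_two_edges[OF C, of u] by blast
  have "x = par u" if "{u, x} \<in> C" for x
  proof -
    have "x \<in> \<Union>C" using that by blast
    then show ?thesis using P[of u x] adj[OF that] u(1) u(2)[of x] by auto
  qed
  then show False using vw by blast
qed

section \<open>The cycle v_1, ..., v_n and graphs in which it is the only cycle\<close>

lemma cycle_links_eq:
  assumes "1 \<le> n"
  shows "cycle_links n = (\<lambda>i. (Cyc (Suc i), Cyc (Suc (Suc i mod n)))) ` {..<n}"
proof (intro equalityI subsetI)
  fix p assume "p \<in> cycle_links n"
  then show "p \<in> (\<lambda>i. (Cyc (Suc i), Cyc (Suc (Suc i mod n)))) ` {..<n}"
    using assms unfolding cycle_links_def
  proof (elim UnE CollectE exE conjE)
    \<comment> \<open>The link leaving \<open>Cyc i\<close> has the zero-based position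
      \<open>i - 1\<close>; the closing link has position \<open>n - 1\<close>.\<close>
    fix i assume "p = (Cyc i, Cyc (Suc i))" "1 \<le> i" "i < n"
    then show ?thesis by (intro image_eqI[of _ _ "i - 1"]) auto
  next
    assume "p \<in> {(Cyc n, Cyc 1)}"
    then show ?thesis using assms by (intro image_eqI[of _ _ "n - 1"]) auto
  qed
next
  fix p assume "p \<in> (\<lambda>i. (Cyc (Suc i), Cyc (Suc (Suc i mod n)))) ` {..<n}"
  then obtain i where i: "i < n" "p = (Cyc (Suc i), Cyc (Suc (Suc i mod n)))" by auto
  show "p \<in> cycle_links n"
  proof (cases "Suc i = n")
    case False
    then show ?thesis using i by (simp add: cycle_links_def)
  qed (use i in \<open>auto simp: cycle_links_def\<close>)
qed

lemma card_cycle_links: "1 \<le> n \<Longrightarrow> card (cycle_links n) = n"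
  unfolding cycle_links_eq by (simp add: card_image inj_on_def)

lemma finite_cycle_links: "finite (cycle_links n)"
proof -
  have "{(Cyc i, Cyc (Suc i)) | i. 1 \<le> i \<and> i < n} \<subseteq> (\<lambda>i. (Cyc i, Cyc (Suc i))) ` {..<n}" by auto
  then show ?thesis unfolding cycle_links_def by (simp add: finite_subset)
qed

lemma asym_cycle_links: "3 \<le> n \<Longrightarrow> cycle_links n \<inter> (cycle_links n)\<inverse> = {}"
  by (auto simp: cycle_links_def)

lemma cycle_links_in_ucycles:
  assumes "3 \<le> n" "cycle_links n \<subseteq> R"
  shows "edge_of ` cycle_links n \<in> ucycles (graph_of R)"
proof -
  define p where "p = map (\<lambda>i. (Cyc (Suc i), Cyc (Suc (Suc i mod n)))) [0..<n]"
  have set_p: "set p = cycle_links n"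
    using assms(1) by (simp add: p_def cycle_links_eq atLeast0LessThan)
  have nth: "p ! i = (Cyc (Suc i), Cyc (Suc (Suc i mod n)))" if "i < n" for i
    using that by (simp add: p_def)
  have len: "length p = n" by (simp add: p_def)
  \<comment> \<open>Successor modulo \<open>n\<close> permutes the positions, so the heads are
    distinct.\<close>
  have "inj_on (\<lambda>i. Suc i mod n) {0..<n}"
    by (rule inj_onI) (auto simp: mod_Suc split: if_splits)
  then have "inj_on (Cyc \<circ> Suc \<circ> (\<lambda>i. Suc i mod n)) {0..<n}"
    by (rule comp_inj_on) (rule inj_onI, simp)
  moreover have "map snd p = map (Cyc \<circ> Suc \<circ> (\<lambda>i. Suc i mod n)) [0..<n]"
    by (simp add: p_def comp_def)
  ultimately have "distinct (map snd p)"
    by (simp only: distinct_map set_upt distinct_upt)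
  moreover have "fst (p ! 0) \<in> Field R"
    using assms nth[of 0] set_p len by (metis FieldI1 less_le_trans nth_mem prod.collapse subsetD zero_less_numeral)
  moreover have "set p \<subseteq> R \<union> R\<inverse>" using set_p assms(2) by blast
  ultimately have "pre_digraph.cycle (with_proj (graph_of R)) p"
    using assms(1) len by (auto simp: cycle_with_proj_iff nth graph_of_def)
  then show ?thesis
    using ucyclesI[of "graph_of R" p] set_p len assms(1) by simp
qed

text \<open>A cycle that reaches a vertex along one link must leave it along another, and only the
  next link is available; one link in \<open>C\<close> thus brings in all of them.\<close>

lemma ucycle_subset_cycle_links:
  assumes n: "3 \<le> n" and C: "C \<in> ucycles G" and sub: "C \<subseteq> edge_of ` cycle_links n"
  shows "C = edge_of ` cycle_links n"
proof -
  define e where "e i = {Cyc (Suc i), Cyc (Suc (Suc i mod n))}" for i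
  have links: "edge_of ` cycle_links n = e ` {..<n}"
    using n by (simp add: cycle_links_eq image_image e_def)
  have step: "e (Suc i mod n) \<in> C" if "e i \<in> C" "i < n" for i
  proof -
    \<comment> \<open>\<open>u\<close> is the common vertex of \<open>e i\<close> and
      \<open>e (Suc i mod n)\<close>. Of two different edges of \<open>C\<close> at
      \<open>u\<close>, at most one leads back to \<open>Cyc (Suc i)\<close>.\<close>
    define u where "u = Cyc (Suc (Suc i mod n))"
    have "u \<in> \<Union>C" using that unfolding u_def e_def by blast
    then obtain v w where vw: "v \<noteq> w" "{u, v} \<in> C" "{u, w} \<in> C"
      by (rule ucycle_two_edges[OF C])
    have "x = Cyc (Suc i) \<or> {u, x} = e (Suc i mod n)" if x: "{u, x} \<in> C" for x
    proof -
      obtain j where j: "j < n" "{u, x} = e j" using x sub links by auto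
      from j(2) consider "Suc i mod n = j" | "Suc i mod n = Suc j mod n" "x = Cyc (Suc j)"
        by (auto simp: u_def e_def doubleton_eq_iff)
      then show ?thesis
      proof cases
        case 1
        then show ?thesis using j by simp
      next
        case 2
        then have "i = j" using j(1) \<open>i < n\<close> by (auto simp: mod_Suc split: if_splits)
        then show ?thesis using 2 by simp
      qed
    qed
    then show ?thesis using vw by metis
  qed
  obtain i where i: "i < n" "e i \<in> C"
    using ucycle_nonempty[OF C] sub unfolding links by blast
  have all: "e ((i + m) mod n) \<in> C" for m
  proof (induction m)
    case (Suc m)
    have "Suc ((i + m) mod n) mod n = (i + Suc m) mod n" by (simp add: mod_Suc_eq)
    moreover have "(i + m) mod n < n" using n by simp
    ultimately show ?case using step[OF Suc.IH] by simp
  qed (use i in simp)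
  have "e j \<in> C" if "j < n" for j
  proof -
    \<comment> \<open>Rotating by \<open>n - i + j\<close> passes the end of the cycle once, which
      avoids a negative difference.\<close>
    have "(i + (n - i + j)) mod n = j" using i(1) that by simp
    then show ?thesis using all[of "n - i + j"] by simp
  qed
  then show ?thesis using sub unfolding links by blast
qed

text \<open>\<open>P\<close> holds the vertices of the attached trees. Pruning keeps every cycle out
  of \<open>P\<close>; by \<open>rest\<close> only cycle links remain, and these contain no smaller
  cycle.\<close>

lemma unicyclic_graph_ofI:
  fixes h :: "vertex \<Rightarrow> nat"
  assumes R: "finite R" "R \<inter> R\<inverse> = {}" and n: "3 \<le> n" and sub: "cycle_links n \<subseteq> R"
    and P: "\<And>u v. u \<in> P \<Longrightarrow> (u, v) \<in> R \<union> R\<inverse> \<Longrightarrow> v = par u \<or> v \<in> P \<and> h u < h v"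
    and rest: "\<And>u v. (u, v) \<in> R \<Longrightarrow> u \<notin> P \<Longrightarrow> v \<notin> P \<Longrightarrow> (u, v) \<in> cycle_links n"
    and root: "(c, d) \<in> R" "\<And>u v. (u, v) \<in> R \<Longrightarrow> (c, u) \<in> R\<^sup>*"
  shows "unicyclic (graph_of R)" "girth (graph_of R) = enat n"
proof -
  have "C = edge_of ` cycle_links n" if C: "C \<in> ucycles (graph_of R)" for C
  proof (rule ucycle_subset_cycle_links[OF n C], rule subsetI)
    fix e assume e: "e \<in> C"
    then obtain p where p: "p \<in> R" "e = edge_of p"
      using ucycle_subset_edges[OF C] by (auto simp: edges_graph_of)
    have "fst p \<notin> P" "snd p \<notin> P"
      using ucycle_disjoint_branches[OF C P] e p(2) by blast+
    then have "p \<in> cycle_links n" using rest[of "fst p" "snd p"] p(1) by simp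
    then show "e \<in> edge_of ` cycle_links n" using p(2) by blast
  qed
  then have cyc: "ucycles (graph_of R) = {edge_of ` cycle_links n}"
    using cycle_links_in_ucycles[OF n sub] by blast
  show "unicyclic (graph_of R)"
    using pair_graph_graph_of[OF R] connected_graph_ofI[OF R root] by (simp add: unicyclic_def cyc)
  have "card (edge_of ` cycle_links n) = n"
    using card_image[OF inj_on_edge_of[OF asym_cycle_links[OF n]]] card_cycle_links[of n] n by simp
  then show "girth (graph_of R) = enat n" by (simp add: girth_def cyc)
qed

section \<open>Relabelling and isomorphism classes\<close>

text \<open>Carries the graphs on \<open>vertex\<close> over to \<open>nat\<close>, where
  isomorphism classes are formed.\<close>

definition relabel :: "('a \<Rightarrow> 'b) \<Rightarrow> 'a pair_pre_digraph \<Rightarrow> 'b pair_pre_digraph" where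
  "relabel f G = \<lparr>pverts = f ` pverts G, parcs = map_prod f f ` parcs G\<rparr>"

lemma pverts_relabel [simp]: "pverts (relabel f G) = f ` pverts G"
  and parcs_relabel [simp]: "parcs (relabel f G) = map_prod f f ` parcs G"
  by (simp_all add: relabel_def)

context
  fixes f :: "'a \<Rightarrow> 'b"
  assumes inj: "inj f"
begin

lemma pair_graph_relabel:
  assumes "pair_graph G"
  shows "pair_graph (relabel f G)"
proof -
  interpret pair_graph G by fact
  show ?thesis
  proof
    fix e assume "e \<in> parcs (relabel f G)"
    then obtain u v where "e = (f u, f v)" "(u, v) \<in> parcs G" by auto
    then show "fst e \<in> pverts (relabel f G)" "snd e \<in> pverts (relabel f G)" "fst e \<noteq> snd e"
      using inj pair_no_loops in_arcsD1 in_arcsD2 by (fastforce simp: inj_eq)+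
  next
    show "finite (pverts (relabel f G))" "finite (parcs (relabel f G))"
      using pair_finite_verts pair_finite_arcs by auto
  next
    have "sym (parcs G)" using pair_sym_arcs by (simp add: symmetric_def)
    have "sym (map_prod f f ` parcs G)"
    proof (rule symI)
      fix a b assume "(a, b) \<in> map_prod f f ` parcs G"
      then obtain u v where "a = f u" "b = f v" "(u, v) \<in> parcs G" by auto
      then show "(b, a) \<in> map_prod f f ` parcs G"
        using symD[OF \<open>sym (parcs G)\<close>] by (auto intro: map_prod_imageI)
    qed
    then show "symmetric (relabel f G)" by (simp add: symmetric_def)
  qed
qed

lemma edges_relabel: "edges (relabel f G) = (`) f ` edges G"
proof (intro equalityI subsetI)
  fix e assume "e \<in> edges (relabel f G)"
  then obtain u v where "e = f ` {u, v}" "(u, v) \<in> parcs G"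
    by (auto simp: edges_def)
  then show "e \<in> (`) f ` edges G"
    by (intro image_eqI[of _ _ "{u, v}"]) (auto simp: edges_def)
next
  fix e assume "e \<in> (`) f ` edges G"
  then obtain u v where "e = {f u, f v}" "(u, v) \<in> parcs G"
    by (auto simp: edges_def)
  moreover from this have "(f u, f v) \<in> parcs (relabel f G)"
    by (auto intro: map_prod_imageI)
  ultimately show "e \<in> edges (relabel f G)"
    unfolding edges_def by blast
qed

lemma inj_image_image: "inj ((`) f)"
  using inj by (simp add: inj_image_eq_iff inj_def)

lemma induced_matching_relabel:
  "induced_matching (relabel f G) ((`) f ` M) \<longleftrightarrow> induced_matching G M"
proof -
  have "(`) f ` M \<subseteq> (`) f ` edges G \<longleftrightarrow> M \<subseteq> edges G"
    using inj_image_image by (rule inj_image_subset_iff)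
  moreover have "f ` e \<inter> f ` g = {} \<longleftrightarrow> e \<inter> g = {}" for e g
    using image_Int[OF inj, of e g] by auto
  moreover have "{f u, f v} \<in> (`) f ` edges G \<longleftrightarrow> {u, v} \<in> edges G" for u v
    using inj_image_mem_iff[OF inj_image_image, of "{u, v}" "edges G"] by simp
  moreover have "f ` e = f ` g \<longleftrightarrow> e = g" for e g
    using inj by (rule inj_image_eq_iff)
  ultimately show ?thesis
    unfolding induced_matching_def edges_relabel by (simp add: ball_simps)
qed

text \<open>Every maximal induced matching of the relabelled graph is the image of one of
  \<open>G\<close> of the same size, since extensions in \<open>G\<close> map to extensions.\<close>

lemma well_indumatched_relabel:
  assumes "well_indumatched G"
  shows "well_indumatched (relabel f G)"
proof -
  have ex: "\<exists>M. maximal_induced_matching G M \<and> card M = card M'"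
    if M': "maximal_induced_matching (relabel f G) M'" for M'
  proof -
    have "M' \<subseteq> (`) f ` edges G"
      using M' by (simp add: maximal_induced_matching_def induced_matching_def edges_relabel)
    then obtain M where M: "M' = (`) f ` M" by (auto simp: subset_image_iff)
    have "N = M" if "induced_matching G N" "M \<subseteq> N" for N
    proof -
      have "(`) f ` N = (`) f ` M"
        using M' that unfolding M maximal_induced_matching_def by (metis image_mono induced_matching_relabel)
      then show ?thesis by (simp add: inj_image_eq_iff[OF inj_image_image])
    qed
    then have "maximal_induced_matching G M"
      using M' by (simp add: M maximal_induced_matching_def induced_matching_relabel)
    moreover have "card M = card M'"
      unfolding M using inj_image_image by (metis card_image inj_on_subset subset_UNIV)
    ultimately show ?thesis by blast
  qed
  have "pair_graph G" using assms by (simp add: well_indumatched_def)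
  then show ?thesis
    using ex assms pair_graph_relabel unfolding well_indumatched_def by metis
qed

lemma connected_relabel:
  assumes "pair_graph G" "Digraph_Component.connected (with_proj G)"
  shows "Digraph_Component.connected (with_proj (relabel f G))"
proof -
  have "(f u, f v) \<in> (map_prod f f ` parcs G)\<^sup>*" if "(u, v) \<in> (parcs G)\<^sup>*" for u v
    using that by induction (auto intro: rtrancl_into_rtrancl)
  then show ?thesis
    using assms by (simp add: connected_pair_graph_iff pair_graph_relabel)
qed

lemma cycle_relabel_iff:
  "pre_digraph.cycle (with_proj (relabel f G)) (map (map_prod f f) p) \<longleftrightarrow>
    pre_digraph.cycle (with_proj G) p"
proof -
  have 1: "map_prod f f ` set p \<subseteq> map_prod f f ` parcs G \<longleftrightarrow> set p \<subseteq> parcs G"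
    using inj by (intro inj_image_subset_iff) (rule prod.inj_map)
  have 2: "map snd (map (map_prod f f) p) = map f (map snd p)"
    by simp
  have 3: "distinct (map f (map snd p)) \<longleftrightarrow> distinct (map snd p)"
    using inj by (metis distinct_map inj_on_subset subset_UNIV)
  have 4: "f x \<in> f ` pverts G \<longleftrightarrow> x \<in> pverts G" for x
    using inj by (rule inj_image_mem_iff)
  show ?thesis
  proof (cases "p = []")
    case False
    then show ?thesis
      unfolding cycle_with_proj_iff 2 3 by (auto simp: 1 4 inj_eq[OF inj])
  qed (simp add: cycle_with_proj_iff)
qed

lemma ucycles_relabel: "ucycles (relabel f G) = (`) ((`) f) ` ucycles G"
proof -
  have edge: "edge_of ` set (map (map_prod f f) p) = (`) f ` edge_of ` set p" for p
    by (simp add: image_image)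
  have "C \<in> ucycles (relabel f G) \<longleftrightarrow> C \<in> (`) ((`) f) ` ucycles G" for C
  proof
    assume "C \<in> ucycles (relabel f G)"
    then obtain q where q: "C = edge_of ` set q" "pre_digraph.cycle (with_proj (relabel f G)) q" "3 \<le> length q"
      by (auto simp: ucycles_def case_prod_beta)
    \<comment> \<open>All arcs of the cycle lie in the range of \<open>map_prod f f\<close>, so the
      whole list can be pulled back.\<close>
    then have "q \<in> lists (range (map_prod f f))"
      by (auto simp: cycle_with_proj_iff)
    then obtain p where p: "q = map (map_prod f f) p" by (auto simp: lists_image)
    have "edge_of ` set p \<in> ucycles G"
      using q(2,3) by (intro ucyclesI) (simp_all add: p cycle_relabel_iff)
    then show "C \<in> (`) ((`) f) ` ucycles G"
      unfolding q(1) p edge by blast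
  next
    assume "C \<in> (`) ((`) f) ` ucycles G"
    then obtain p where p: "C = (`) f ` edge_of ` set p" "pre_digraph.cycle (with_proj G) p" "3 \<le> length p"
      by (auto simp: ucycles_def case_prod_beta)
    then show "C \<in> ucycles (relabel f G)"
      unfolding p(1) edge[symmetric] by (intro ucyclesI) (simp_all add: cycle_relabel_iff)
  qed
  then show ?thesis by blast
qed

lemma undirected_tree_relabel: "undirected_tree G \<Longrightarrow> undirected_tree (relabel f G)"
  by (simp add: undirected_tree_def pair_graph_relabel connected_relabel ucycles_relabel)

lemma unicyclic_relabel: "unicyclic G \<Longrightarrow> unicyclic (relabel f G)"
  unfolding unicyclic_def by (auto simp: pair_graph_relabel connected_relabel ucycles_relabel)

lemma girth_relabel: "girth (relabel f G) = girth G"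
proof -
  have "card ((`) f ` C) = card C" for C
    using inj_image_image by (metis card_image inj_on_subset subset_UNIV)
  then show ?thesis by (simp add: girth_def ucycles_relabel image_image)
qed

end

section \<open>Isomorphism classes distinguished by the number of vertices\<close>

lemma card_pverts_graph_iso_rel:
  assumes "(G, H) \<in> graph_iso_rel"
  shows "card (pverts G) = card (pverts H)"
proof -
  obtain hom where hom: "pre_digraph.digraph_isomorphism (with_proj G) hom"
      "with_proj H = app_iso hom (with_proj G)"
    using assms by (auto simp: graph_iso_rel_def digraph_iso_def)
  then have "pverts H = iso_verts hom ` pverts G"
    by (metis verts_app_iso with_proj_simps(1))
  moreover have "inj_on (iso_verts hom) (pverts G)"
    using hom(1) by (simp add: pre_digraph.digraph_isomorphism_def)
  ultimately show ?thesis by (simp add: card_image)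
qed

text \<open>The number of vertices is constant on each class, so finitely many classes would bound
  it on \<open>X\<close>.\<close>

lemma infinite_quotient_graph_iso_rel:
  assumes X: "X \<subseteq> Collect pair_graph" and unbounded: "\<And>n. \<exists>G\<in>X. n \<le> card (pverts G)"
  shows "infinite (X // graph_iso_rel)"
proof
  assume "finite (X // graph_iso_rel)"
  \<comment> \<open>\<open>N K\<close> reads off the vertex number of a class \<open>K\<close>; the
    choice is determined because all members agree.\<close>
  moreover define N where "N K = (SOME n. \<exists>G\<in>K. n = card (pverts G))" for K :: "nat pair_pre_digraph set"
  ultimately have "finite (N ` (X // graph_iso_rel))"
    by simp
  moreover have "card (pverts G) \<in> N ` (X // graph_iso_rel)" if G: "G \<in> X" for G
  proof -
    let ?K = "graph_iso_rel `` {G}"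
    have "G \<in> ?K"
      using X G equiv_class_self[OF equiv_graph_iso_rel, of G] by blast
    moreover have "card (pverts H) = card (pverts G)" if "H \<in> ?K" for H
      using card_pverts_graph_iso_rel[of G H] that by simp
    ultimately have "N ?K = card (pverts G)"
      unfolding N_def by (intro some_equality) blast+
    then show ?thesis
      using imageI[OF quotientI[OF G, of graph_iso_rel], of N] by simp
  qed
  then have "(\<lambda>G. card (pverts G)) ` X \<subseteq> N ` (X // graph_iso_rel)" by blast
  ultimately have "finite ((\<lambda>G. card (pverts G)) ` X)" by (rule rev_finite_subset)
  then obtain m where "\<And>G. G \<in> X \<Longrightarrow> card (pverts G) \<le> m"
    by (metis finite_nat_set_iff_bounded_le imageI)
  then show False using unbounded[of "Suc m"] by (metis not_less_eq_eq)
qed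

text \<open>Provides the injection \<open>to_nat\<close> used for relabelling.\<close>

instance vertex :: countable
  by countable_datatype

lemma infinite_quotient_relabelled_family:
  fixes g :: "nat \<Rightarrow> vertex pair_pre_digraph"
  assumes g: "\<And>r. 1 \<le> r \<Longrightarrow> relabel to_nat (g r) \<in> X" and X: "X \<subseteq> Collect pair_graph"
    and legs: "\<And>r. (\<lambda>i. Leg i 1) ` {..<r} \<subseteq> pverts (g r)"
  shows "infinite (X // graph_iso_rel)"
proof (rule infinite_quotient_graph_iso_rel[OF X])
  fix n
  \<comment> \<open>\<open>Suc n\<close> meets the bound \<open>1 \<le> r\<close> even for
    \<open>n = 0\<close>.\<close>
  let ?G = "relabel to_nat (g (Suc n)) :: nat pair_pre_digraph"
  have "?G \<in> X" using g by simp
  then have fin: "finite (pverts ?G)"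
    using X pair_graph.axioms(1) pair_digraph.axioms(1) pair_fin_digraph.pair_finite_verts by blast
  have "(\<lambda>i. to_nat (Leg i 1)) ` {..<Suc n} \<subseteq> pverts ?G"
    using legs[of "Suc n"] by auto
  then have "card ((\<lambda>i. to_nat (Leg i 1)) ` {..<Suc n}) \<le> card (pverts ?G)"
    using fin by (rule card_mono[rotated])
  then have "n \<le> card (pverts ?G)" by (simp add: card_image inj_on_def)
  then show "\<exists>G\<in>X. n \<le> card (pverts G)" using \<open>?G \<in> X\<close> by blast
qed

section \<open>Spiders\<close>

lemma mem_spider_links:
  "(u, v) \<in> spider_links c r k \<longleftrightarrow> (\<exists>i<r. u = c \<and> v = Leg i 1) \<or>
    (\<exists>i j. u = Leg i j \<and> v = Leg i (Suc j) \<and> i < r \<and> 1 \<le> j \<and> j \<le> k)"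
  by (auto simp: spider_links_def)

lemma mem_cycle_links:
  "(u, v) \<in> cycle_links n \<longleftrightarrow>
    (\<exists>i. u = Cyc i \<and> v = Cyc (Suc i) \<and> 1 \<le> i \<and> i < n) \<or> u = Cyc n \<and> v = Cyc 1"
  by (auto simp: cycle_links_def)

lemma finite_spider_links: "finite (spider_links c r k)"
proof -
  have "spider_links c r k \<subseteq> (\<lambda>i. (c, Leg i 1)) ` {..<r} \<union>
      (\<lambda>(i, j). (Leg i j, Leg i (Suc j))) ` ({..<r} \<times> {..k})"
    by (auto simp: spider_links_def)
  then show ?thesis by (rule finite_subset) simp
qed

text \<open>\<open>Suc j\<close> with \<open>j \<le> k\<close> runs through all positions on the
  leg, the leaf at \<open>Suc k\<close> included.\<close>

lemma rtrancl_spider_links: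
  assumes "spider_links c r k \<subseteq> R" "i < r" "j \<le> k"
  shows "(c, Leg i (Suc j)) \<in> R\<^sup>*"
  using assms(3)
proof (induction j)
  case 0
  have "(c, Leg i (Suc 0)) \<in> R"
    using assms(1,2) mem_spider_links[of c "Leg i (Suc 0)" c r k] by auto
  then show ?case by blast
next
  case (Suc j)
  have "(Leg i (Suc j), Leg i (Suc (Suc j))) \<in> R"
    using assms(1,2) Suc.prems mem_spider_links[of "Leg i (Suc j)" "Leg i (Suc (Suc j))" c r k] by auto
  then show ?case using Suc by (meson Suc_leD rtrancl.rtrancl_into_rtrancl)
qed

lemma rtrancl_cycle_links:
  assumes "cycle_links n \<subseteq> R" "Suc i \<le> n"
  shows "(Cyc 1, Cyc (Suc i)) \<in> R\<^sup>*"
  using assms(2)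
proof (induction i)
  case (Suc i)
  have "(Cyc (Suc i), Cyc (Suc (Suc i))) \<in> R"
    using assms(1) Suc.prems mem_cycle_links[of "Cyc (Suc i)" "Cyc (Suc (Suc i))" n] by auto
  then show ?case using Suc by (meson Suc_leD rtrancl.rtrancl_into_rtrancl)
qed simp

lemma rtrancl_spider_links_source:
  assumes "spider_links c r k \<subseteq> R" "(u, v) \<in> spider_links c r k"
  shows "(c, u) \<in> R\<^sup>*"
  using assms(2) unfolding mem_spider_links
proof (elim disjE exE conjE)
  fix i j assume "u = Leg i j" "i < r" "1 \<le> j" "j \<le> k"
  then show ?thesis using rtrancl_spider_links[OF assms(1), of i "j - 1"] by simp
qed simp

lemma rtrancl_cycle_links_source:
  assumes "cycle_links n \<subseteq> R" "1 \<le> n" "(u, v) \<in> cycle_links n"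
  shows "(Cyc 1, u) \<in> R\<^sup>*"
proof -
  obtain i where "u = Cyc (Suc i)" "Suc i \<le> n"
    using assms(3) unfolding mem_cycle_links
  proof (elim disjE exE conjE)
    fix i assume "u = Cyc i" "1 \<le> i" "i < n"
    then show thesis using that[of "i - 1"] by simp
  next
    assume "u = Cyc n"
    then show thesis using that[of "n - 1"] assms(2) by simp
  qed
  then show ?thesis using rtrancl_cycle_links[OF assms(1)] by simp
qed

text \<open>Serves as the set \<open>P\<close> of pruning for all the unicyclic graphs.\<close>

definition branch :: "vertex set" where
  "branch = - range Cyc"

text \<open>The height for pruning. \<open>Center\<close> gets 0 and so lies below every
  \<open>Leg i 1\<close>.\<close>

fun depth :: "vertex \<Rightarrow> nat" where
  "depth (Leg i j) = j" | "depth (Pend i j) = j" | "depth _ = 0"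

text \<open>The first argument is the center of the spider; \<open>Center\<close> itself only has a parent in \<open>G\<^sub>r\<close>.\<close>

fun parent :: "vertex \<Rightarrow> vertex \<Rightarrow> vertex" where
  "parent c (Leg i j) = (if j = 1 then c else Leg i (j - 1))"
| "parent c (Pend i j) = (if j = 1 then Cyc i else Pend i (j - 1))"
| "parent c _ = Cyc 1"

lemma Cyc_notin_branch [simp]: "Cyc i \<notin> branch"
  and Leg_in_branch [simp]: "Leg i j \<in> branch"
  and Pend_in_branch [simp]: "Pend i j \<in> branch"
  and Center_in_branch [simp]: "Center \<in> branch"
  by (auto simp: branch_def)

text \<open>The leaf edge reaches no further than \<open>Leg i 1\<close>, so whatever conflicts with
  it touches the leg outside the center. The three edges form a path, whose middle edge joins the
  outer two. Selecting by \<open>snd\<close> includes the edge at the center.\<close>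

lemma simplicial_block_leg:
  assumes "\<And>i j. Leg i j \<notin> Field T" "\<And>i j. c \<noteq> Leg i j" "i < r"
  shows "simplicial_block (T \<union> spider_links c r 2) (Leg i 2, Leg i 3)
    {p \<in> T \<union> spider_links c r 2. \<exists>j. snd p = Leg i j}"
proof -
  let ?B = "{(c, Leg i 1), (Leg i 1, Leg i 2), (Leg i 2, Leg i 3)}"
  have T: "(u, Leg i j) \<notin> T" "(Leg i j, u) \<notin> T" for u i j
    using assms(1)[of i j] by (auto simp: Field_def)
  have B: "{p \<in> T \<union> spider_links c r 2. \<exists>j. snd p = Leg i j} = ?B"
  proof -
    have "p \<in> ?B" if "p \<in> T \<union> spider_links c r 2" "snd p = Leg i j" for p j
      using that T by (cases p) (auto simp: mem_spider_links le_Suc_eq numeral_eq_Suc)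
    moreover have "?B \<subseteq> spider_links c r 2"
      using assms(3) by (auto simp: mem_spider_links)
    ultimately show ?thesis by auto
  qed
  have "simplicial_block (T \<union> spider_links c r 2) (Leg i 2, Leg i 3) ?B"
    unfolding simplicial_block_def
  proof (intro conjI)
    show "?B \<subseteq> T \<union> spider_links c r 2"
      using assms(3) by (auto simp: mem_spider_links)
    show "\<forall>p\<in>T \<union> spider_links c r 2. conflict (T \<union> spider_links c r 2) p (Leg i 2, Leg i 3) \<longrightarrow> p \<in> ?B"
    proof (intro ballI impI)
      fix p assume p: "p \<in> T \<union> spider_links c r 2"
        and "conflict (T \<union> spider_links c r 2) p (Leg i 2, Leg i 3)"
      then obtain u v where uv: "u \<in> edge_of p" "v \<in> {Leg i 2, Leg i 3}"
          "u = v \<or> (u, v) \<in> T \<union> spider_links c r 2 \<or> (v, u) \<in> T \<union> spider_links c r 2"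
        by (auto simp: conflict_def)
      have "\<exists>j. u = Leg i j"
        using uv(2,3) by (auto simp: mem_spider_links T assms(2) assms(2)[symmetric])
      then have "\<exists>j. snd p = Leg i j"
        using uv(1) p by (cases p) (auto simp: mem_spider_links T assms(2) assms(2)[symmetric])
      then show "p \<in> ?B" using p B by blast
    qed
    show "\<forall>p\<in>?B. \<forall>q\<in>?B. conflict (T \<union> spider_links c r 2) p q"
      using assms(3) by (auto simp: conflict_def mem_spider_links)
  qed simp
  then show ?thesis using B by simp
qed

text \<open>The legs are blocks by \<open>simplicial_block_leg\<close>, so only \<open>T\<close> has
  to be split. Conflicts are still taken in the whole graph: each \<open>s x\<close> must avoid
  conflict with the leg edges at \<open>c\<close>.\<close>

lemma well_indumatched_spiderI:
  assumes "finite T" "T \<inter> T\<inverse> = {}"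
    and legs: "\<And>i j. Leg i j \<notin> Field T" and c: "\<And>i j. c \<noteq> Leg i j"
    and blocks: "\<And>x. x \<in> g ` T \<Longrightarrow> simplicial_block (T \<union> spider_links c r 2) (s x) {p \<in> T. g p = x}"
  shows "well_indumatched (graph_of (T \<union> spider_links c r 2))"
proof -
  let ?R = "T \<union> spider_links c r 2"
  \<comment> \<open>\<open>Inl\<close> labels the legs, \<open>Inr\<close> the blocks of
    \<open>T\<close>.\<close>
  define lab where "lab p = (case snd p of Leg i j \<Rightarrow> Inl i | _ \<Rightarrow> Inr (g p))" for p
  define t where "t x = (case x of Inl i \<Rightarrow> (Leg i 2, Leg i 3) | Inr y \<Rightarrow> s y)" for x
  have T: "(u, Leg i j) \<notin> T" "(Leg i j, u) \<notin> T" for u i j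
    using legs[of i j] by (auto simp: Field_def)
  have lab_T: "lab p = Inr (g p)" if "p \<in> T" for p
    using that T by (cases p) (auto simp: lab_def split: vertex.split)
  have lab_spider: "\<exists>i<r. \<exists>j. lab p = Inl i \<and> snd p = Leg i j" if "p \<in> spider_links c r 2" for p
    using that by (cases p) (auto simp: lab_def mem_spider_links)
  show ?thesis
  proof (rule well_indumatched_if_simplicial_blocks)
    show "finite ?R" using assms(1) by (simp add: finite_spider_links)
    show "?R \<inter> ?R\<inverse> = {}"
      using assms(2) by (auto simp: mem_spider_links T c c[symmetric])
  next
    fix x assume "x \<in> lab ` ?R"
    then obtain p where p: "p \<in> ?R" "x = lab p" by blast
    show "simplicial_block ?R (t x) {p \<in> ?R. lab p = x}"
    proof (cases "p \<in> T")
      case True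
      then have x: "x = Inr (g p)" using p(2) lab_T by simp
      have "{p \<in> ?R. lab p = x} = {q \<in> T. g q = g p}"
        using lab_T lab_spider by (fastforce simp: x)
      then show ?thesis using blocks[of "g p"] True by (simp add: x t_def)
    next
      case False
      then obtain i where i: "i < r" "x = Inl i" using lab_spider p by blast
      have "lab q = Inl i \<longleftrightarrow> (\<exists>j. snd q = Leg i j)" for q
        by (auto simp: lab_def split: vertex.split)
      then show ?thesis using simplicial_block_leg[of T c, OF legs c i(1)] by (simp add: i(2) t_def)
    qed
  qed
qed

section \<open>The tree S_{r,2}\<close>

lemma S_graph_links: "S_graph r 2 = graph_of ({} \<union> spider_links Center r 2)"
  by (simp add: S_graph_def)

lemma well_indumatched_S: "well_indumatched (S_graph r 2)"
  unfolding S_graph_links by (rule well_indumatched_spiderI) auto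

lemma undirected_tree_S:
  assumes "1 \<le> r"
  shows "undirected_tree (S_graph r 2)"
proof -
  let ?R = "spider_links Center r 2"
  have R: "finite ?R" "?R \<inter> ?R\<inverse> = {}"
    by (auto simp: finite_spider_links mem_spider_links)
  have "Digraph_Component.connected (with_proj (graph_of ?R))"
    using R
  proof (rule connected_graph_ofI)
    show "(Center, Leg 0 1) \<in> ?R" using assms by (auto simp: mem_spider_links)
  qed (rule rtrancl_spider_links_source[OF subset_refl])
  moreover have "ucycles (graph_of ?R) = {}"
  proof -
    have False if C: "C \<in> ucycles (graph_of ?R)" for C
    proof -
      \<comment> \<open>Pruning applies to all vertices at once, as \<open>Center\<close> has only
        deeper neighbours.\<close>
      have "\<Union>C \<inter> UNIV = {}"
        using C
      proof (rule ucycle_disjoint_branches[where par = "parent Center" and h = depth])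
        fix u v assume "(u, v) \<in> ?R \<union> ?R\<inverse>"
        then show "v = parent Center u \<or> v \<in> UNIV \<and> depth u < depth v"
          by (auto simp: mem_spider_links)
      qed
      moreover obtain e where "e \<in> C" using ucycle_nonempty[OF C] by blast
      moreover have "e \<in> edges (graph_of ?R)" using ucycle_subset_edges[OF C] \<open>e \<in> C\<close> by blast
      ultimately show False by (auto simp: edges_graph_of)
    qed
    then show ?thesis by blast
  qed
  ultimately show ?thesis
    using pair_graph_graph_of[OF R] by (simp add: undirected_tree_def S_graph_def)
qed

section \<open>Spiders attached to cycles\<close>

lemma cycle_links_3: "cycle_links 3 = {(Cyc 1, Cyc 2), (Cyc 2, Cyc 3), (Cyc 3, Cyc 1)}"
  by (auto simp: cycle_links_eq lessThan_nat_numeral)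
lemma cycle_links_5:
  "cycle_links 5 = {(Cyc 1, Cyc 2), (Cyc 2, Cyc 3), (Cyc 3, Cyc 4), (Cyc 4, Cyc 5), (Cyc 5, Cyc 1)}"
  by (auto simp: cycle_links_eq lessThan_nat_numeral)
lemma cycle_links_7:
  "cycle_links 7 = {(Cyc 1, Cyc 2), (Cyc 2, Cyc 3), (Cyc 3, Cyc 4), (Cyc 4, Cyc 5), (Cyc 5, Cyc 6),
    (Cyc 6, Cyc 7), (Cyc 7, Cyc 1)}"
  by (auto simp: cycle_links_eq lessThan_nat_numeral)

text \<open>All five edges outside the legs meet the triangle and hence conflict pairwise. The
  pendant edge at \<open>Cyc 2\<close> does not reach \<open>Center\<close>, so no leg edge
  conflicts with it.\<close>

lemma well_indumatched_G: "well_indumatched (G_graph r)"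
proof -
  let ?T = "cycle_links 3 \<union> {(Center, Cyc 1), (Cyc 2, Pend 2 1)}"
  have "well_indumatched (graph_of (?T \<union> spider_links Center r 2))"
  proof (rule well_indumatched_spiderI[where g = "\<lambda>_. ()" and s = "\<lambda>_. (Cyc 2, Pend 2 1)"])
    show "finite ?T" "?T \<inter> ?T\<inverse> = {}"
      by (auto simp: cycle_links_3)
    show "Leg i j \<notin> Field ?T" for i j
      by (auto simp: cycle_links_3 Field_def)
    show "simplicial_block (?T \<union> spider_links Center r 2) (Cyc 2, Pend 2 1) {p \<in> ?T. () = x}" for x
      unfolding simplicial_block_def
      by (auto simp: cycle_links_3 conflict_def mem_spider_links)
  qed simp
  then show ?thesis by (simp add: G_graph_def Un_ac)
qed

text \<open>Any two edges of a 5-cycle conflict. \<open>(Cyc 3, Cyc 4)\<close> lies opposite to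
  \<open>Cyc 1\<close>: neither endpoint is adjacent to \<open>Cyc 1\<close>, so no leg edge
  conflicts with it.\<close>

lemma well_indumatched_H: "well_indumatched (H_graph r)"
  unfolding H_graph_def
proof (rule well_indumatched_spiderI[where g = "\<lambda>_. ()" and s = "\<lambda>_. (Cyc 3, Cyc 4)"])
  show "finite (cycle_links 5)" "cycle_links 5 \<inter> (cycle_links 5)\<inverse> = {}"
    by (simp_all add: finite_cycle_links asym_cycle_links)
  show "Leg i j \<notin> Field (cycle_links 5)" for i j
    by (auto simp: cycle_links_5 Field_def)
  show "simplicial_block (cycle_links 5 \<union> spider_links (Cyc 1) r 2) (Cyc 3, Cyc 4)
      {p \<in> cycle_links 5. () = x}" for x
    unfolding simplicial_block_def
    by (auto simp: cycle_links_5 conflict_def mem_spider_links)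
qed simp

section \<open>Unicyclicity and girth of G_r, H_r and L_r\<close>

lemma unicyclic_G:
  shows "unicyclic (G_graph r)" "girth (G_graph r) = 3"
proof -
  let ?R = "cycle_links 3 \<union> spider_links Center r 2 \<union> {(Center, Cyc 1), (Cyc 2, Pend 2 1)}"
  have R: "finite ?R" "?R \<inter> ?R\<inverse> = {}" "(3::nat) \<le> 3" "cycle_links 3 \<subseteq> ?R"
    by (auto simp: finite_spider_links finite_cycle_links mem_spider_links cycle_links_3)
  have branches: "v = parent Center u \<or> v \<in> branch \<and> depth u < depth v"
    if "u \<in> branch" "(u, v) \<in> ?R \<union> ?R\<inverse>" for u v
    using that by (auto simp: mem_spider_links mem_cycle_links)
  have rest: "(u, v) \<in> cycle_links 3" if "(u, v) \<in> ?R" "u \<notin> branch" "v \<notin> branch" for u v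
    using that by (auto simp: mem_spider_links)
  \<comment> \<open>The link between spider and triangle points away from \<open>Center\<close>, so
    \<open>Center\<close> is the root and the cycle is reached through \<open>Cyc 1\<close>.\<close>
  have root: "(Center, Cyc 1) \<in> ?R" by simp
  have cyc: "(Center, u) \<in> ?R\<^sup>*" if "(Cyc 1, u) \<in> ?R\<^sup>*" for u
    using root that by (rule converse_rtrancl_into_rtrancl)
  have reach: "(Center, u) \<in> ?R\<^sup>*" if "(u, v) \<in> ?R" for u v
    using that
  proof (elim UnE)
    assume "(u, v) \<in> cycle_links 3"
    then show ?thesis by (intro cyc rtrancl_cycle_links_source[OF R(4)]) auto
  next
    assume "(u, v) \<in> spider_links Center r 2"
    then show ?thesis by (rule rtrancl_spider_links_source[rotated]) auto
  next
    have "(Center, Cyc (Suc 1)) \<in> ?R\<^sup>*"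
      by (intro cyc rtrancl_cycle_links[OF R(4)]) simp
    then show ?thesis if "(u, v) \<in> {(Center, Cyc 1), (Cyc 2, Pend 2 1)}"
      using that by (auto simp: numeral_2_eq_2)
  qed
  show "unicyclic (G_graph r)" "girth (G_graph r) = 3"
    using unicyclic_graph_ofI[OF R branches rest root reach]
    by (simp_all add: G_graph_def numeral_eq_enat)
qed

lemma unicyclic_H:
  shows "unicyclic (H_graph r)" "girth (H_graph r) = 5"
proof -
  let ?R = "cycle_links 5 \<union> spider_links (Cyc 1) r 2"
  have R: "finite ?R" "?R \<inter> ?R\<inverse> = {}" "(3::nat) \<le> 5" "cycle_links 5 \<subseteq> ?R"
    by (auto simp: finite_spider_links finite_cycle_links mem_spider_links mem_cycle_links)
  have branches: "v = parent (Cyc 1) u \<or> v \<in> branch \<and> depth u < depth v"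
    if "u \<in> branch" "(u, v) \<in> ?R \<union> ?R\<inverse>" for u v
    using that by (auto simp: mem_spider_links mem_cycle_links)
  have rest: "(u, v) \<in> cycle_links 5" if "(u, v) \<in> ?R" "u \<notin> branch" "v \<notin> branch" for u v
    using that by (auto simp: mem_spider_links)
  have root: "(Cyc 1, Cyc 2) \<in> ?R" by (simp add: mem_cycle_links)
  have reach: "(Cyc 1, u) \<in> ?R\<^sup>*" if "(u, v) \<in> ?R" for u v
    using that
  proof (elim UnE)
    assume "(u, v) \<in> cycle_links 5"
    then show ?thesis by (intro rtrancl_cycle_links_source[OF R(4)]) auto
  next
    assume "(u, v) \<in> spider_links (Cyc 1) r 2"
    then show ?thesis by (rule rtrancl_spider_links_source[rotated]) auto
  qed
  show "unicyclic (H_graph r)" "girth (H_graph r) = 5"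
    using unicyclic_graph_ofI[OF R branches rest root reach]
    by (simp_all add: H_graph_def numeral_eq_enat)
qed

lemma unicyclic_L:
  shows "unicyclic (L_graph r)" "girth (L_graph r) = 7"
proof -
  let ?R = "cycle_links 7 \<union> spider_links (Cyc 1) r 3 \<union> {(Cyc 2, Pend 2 1)}"
  have R: "finite ?R" "?R \<inter> ?R\<inverse> = {}" "(3::nat) \<le> 7" "cycle_links 7 \<subseteq> ?R"
    by (auto simp: finite_spider_links finite_cycle_links mem_spider_links mem_cycle_links)
  have branches: "v = parent (Cyc 1) u \<or> v \<in> branch \<and> depth u < depth v"
    if "u \<in> branch" "(u, v) \<in> ?R \<union> ?R\<inverse>" for u v
    using that by (auto simp: mem_spider_links mem_cycle_links)
  have rest: "(u, v) \<in> cycle_links 7" if "(u, v) \<in> ?R" "u \<notin> branch" "v \<notin> branch" for u v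
    using that by (auto simp: mem_spider_links)
  have root: "(Cyc 1, Cyc 2) \<in> ?R" by (simp add: mem_cycle_links)
  have reach: "(Cyc 1, u) \<in> ?R\<^sup>*" if "(u, v) \<in> ?R" for u v
    using that
  proof (elim UnE)
    assume "(u, v) \<in> cycle_links 7"
    then show ?thesis by (intro rtrancl_cycle_links_source[OF R(4)]) auto
  next
    assume "(u, v) \<in> spider_links (Cyc 1) r 3"
    then show ?thesis by (rule rtrancl_spider_links_source[rotated]) auto
  next
    assume "(u, v) \<in> {(Cyc 2, Pend 2 1)}"
    then show ?thesis using root by blast
  qed
  show "unicyclic (L_graph r)" "girth (L_graph r) = 7"
    using unicyclic_graph_ofI[OF R branches rest root reach]
    by (simp_all add: L_graph_def numeral_eq_enat)
qed

section \<open>The graphs Q_{k,r}\<close>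

definition pendant_links :: "nat \<Rightarrow> vertex rel" where
  "pendant_links k = (\<Union>i\<in>{i. even i \<and> 2 \<le> i \<and> i \<le> k}. {(Cyc i, Pend i 1), (Pend i 1, Pend i 2)})"

lemma mem_pendant_links:
  "(u, v) \<in> pendant_links k \<longleftrightarrow>
    (\<exists>i. u = Cyc i \<and> v = Pend i 1 \<and> even i \<and> 2 \<le> i \<and> i \<le> k) \<or>
    (\<exists>i. u = Pend i 1 \<and> v = Pend i 2 \<and> even i \<and> 2 \<le> i \<and> i \<le> k)"
  by (auto simp: pendant_links_def)

lemma finite_pendant_links: "finite (pendant_links k)"
  unfolding pendant_links_def by (rule finite_UN_I) (auto intro: finite_subset[of _ "{..k}"])

lemma asym_Q_links:
  assumes "3 \<le> k"
  shows "(cycle_links k \<union> spider_links (Cyc 1) r 2 \<union> pendant_links k) \<inter>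
    (cycle_links k \<union> spider_links (Cyc 1) r 2 \<union> pendant_links k)\<inverse> = {}"
proof -
  have "(v, u) \<notin> cycle_links k \<union> spider_links (Cyc 1) r 2 \<union> pendant_links k"
    if "(u, v) \<in> cycle_links k \<union> spider_links (Cyc 1) r 2 \<union> pendant_links k" for u v
    using that
  proof (elim UnE)
    assume uv: "(u, v) \<in> cycle_links k"
    then have "(v, u) \<notin> cycle_links k" using asym_cycle_links[OF assms] by blast
    moreover obtain i j where "u = Cyc i" "v = Cyc j" using uv by (auto simp: mem_cycle_links)
    ultimately show ?thesis by (simp add: mem_spider_links mem_pendant_links)
  next
    assume "(u, v) \<in> spider_links (Cyc 1) r 2"
    then show ?thesis by (auto simp: mem_cycle_links mem_spider_links mem_pendant_links)
  next
    assume uv: "(u, v) \<in> pendant_links k"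
    then have "(v, u) \<notin> cycle_links k" by (auto simp: mem_cycle_links mem_pendant_links)
    moreover have "(v, u) \<notin> spider_links (Cyc 1) r 2"
      using uv by (auto simp: mem_spider_links mem_pendant_links)
    moreover have "(v, u) \<notin> pendant_links k"
      using uv unfolding mem_pendant_links by (elim disjE exE conjE) simp_all
    ultimately show ?thesis by simp
  qed
  then show ?thesis by blast
qed

lemma Q_graph_links: "Q_graph k r = graph_of (cycle_links k \<union> spider_links (Cyc 1) r 2 \<union> pendant_links k)"
  by (simp add: Q_graph_def pendant_links_def)

lemma unicyclic_Q:
  assumes "4 \<le> k"
  shows "unicyclic (Q_graph k r)" "girth (Q_graph k r) = enat k"
proof -
  let ?R = "cycle_links k \<union> spider_links (Cyc 1) r 2 \<union> pendant_links k"
  have R: "finite ?R" "?R \<inter> ?R\<inverse> = {}" "3 \<le> k" "cycle_links k \<subseteq> ?R"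
    using assms asym_Q_links[of k r]
    by (simp_all add: finite_spider_links finite_cycle_links finite_pendant_links le_supI1)
  have branches: "v = parent (Cyc 1) u \<or> v \<in> branch \<and> depth u < depth v"
    if "u \<in> branch" "(u, v) \<in> ?R \<union> ?R\<inverse>" for u v
    using that by (auto simp: mem_spider_links mem_cycle_links mem_pendant_links)
  have rest: "(u, v) \<in> cycle_links k" if "(u, v) \<in> ?R" "u \<notin> branch" "v \<notin> branch" for u v
    using that by (auto simp: mem_spider_links mem_pendant_links)
  have root: "(Cyc 1, Cyc 2) \<in> ?R" using assms by (simp add: mem_cycle_links)
  have reach: "(Cyc 1, u) \<in> ?R\<^sup>*" if "(u, v) \<in> ?R" for u v
    using that
  proof (elim UnE)
    assume "(u, v) \<in> cycle_links k"
    then show ?thesis using assms by (intro rtrancl_cycle_links_source[OF R(4)]) auto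
  next
    assume "(u, v) \<in> spider_links (Cyc 1) r 2"
    then show ?thesis by (rule rtrancl_spider_links_source[rotated]) auto
  next
    assume "(u, v) \<in> pendant_links k"
    then obtain i where i: "even i" "2 \<le> i" "i \<le> k" "u = Cyc i \<or> u = Pend i 1"
      by (auto simp: mem_pendant_links)
    have "(Cyc 1, Cyc i) \<in> ?R\<^sup>*"
      using rtrancl_cycle_links[OF R(4), of "i - 1"] i by simp
    moreover have "(Cyc i, Pend i 1) \<in> ?R"
      using i by (auto simp: mem_pendant_links)
    ultimately show ?thesis using i(4) by (meson rtrancl.rtrancl_into_rtrancl)
  qed
  show "unicyclic (Q_graph k r)" "girth (Q_graph k r) = enat k"
    using unicyclic_graph_ofI[OF R branches rest root reach]
    by (simp_all add: Q_graph_links)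
qed

text \<open>For even \<open>k\<close>, every cycle edge has exactly one endpoint of even index and
  is counted with the path attached there.\<close>

fun pendant_index :: "vertex \<times> vertex \<Rightarrow> nat" where
  "pendant_index (Cyc i, Cyc j) = (if even i then i else j)"
| "pendant_index (_, Pend i j) = i"
| "pendant_index _ = 0"

text \<open>The block of an even \<open>i\<close> consists of the two path edges and the two cycle
  edges belonging to \<open>Cyc i\<close>. Each touches \<open>Cyc i\<close> or
  \<open>Pend i 1\<close>, which are adjacent, so they conflict pairwise; the outer path edge
  reaches no further than \<open>Cyc i\<close>.\<close>

lemma well_indumatched_Q:
  assumes "even k" "4 \<le> k"
  shows "well_indumatched (Q_graph k r)"
proof -
  let ?T = "cycle_links k \<union> pendant_links k"
  let ?R = "?T \<union> spider_links (Cyc 1) r 2"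
  have index: "even (pendant_index p) \<and> 2 \<le> pendant_index p \<and> pendant_index p \<le> k \<and>
      (p = (Pend (pendant_index p) 1, Pend (pendant_index p) 2) \<or> Cyc (pendant_index p) \<in> edge_of p)"
    if "p \<in> ?T" for p
  proof -
    have pos: "2 \<le> i" if "even i" "Suc 0 \<le> i" for i :: nat
      using that by presburger
    show ?thesis
      using that assms
      by (cases p) (auto simp: mem_cycle_links mem_pendant_links intro: pos split: if_splits)
  qed
  have "well_indumatched (graph_of ?R)"
  proof (rule well_indumatched_spiderI[where g = pendant_index and s = "\<lambda>i. (Pend i 1, Pend i 2)"])
    show "finite ?T" "?T \<inter> ?T\<inverse> = {}"
      using assms asym_Q_links[of k r] by (auto simp: finite_cycle_links finite_pendant_links)
    show "Leg i j \<notin> Field ?T" for i j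
      by (auto simp: Field_def mem_cycle_links mem_pendant_links)
  next
    fix i assume "i \<in> pendant_index ` ?T"
    then have i: "even i" "2 \<le> i" "i \<le> k" using index by blast+
    have link: "(Cyc i, Pend i 1) \<in> ?R" "(Pend i 1, Pend i 2) \<in> ?T"
      using i by (auto simp: mem_pendant_links)
    show "simplicial_block ?R (Pend i 1, Pend i 2) {p \<in> ?T. pendant_index p = i}"
      unfolding simplicial_block_def
    proof (intro conjI ballI impI)
      show "(Pend i 1, Pend i 2) \<in> {p \<in> ?T. pendant_index p = i}" using link(2) by simp
      show "{p \<in> ?T. pendant_index p = i} \<subseteq> ?R" by blast
    next
      fix p assume p: "p \<in> ?R" and "conflict ?R p (Pend i 1, Pend i 2)"
      then obtain u v where uv: "u \<in> edge_of p" "v \<in> {Pend i 1, Pend i 2}"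
          "u = v \<or> (u, v) \<in> ?R \<or> (v, u) \<in> ?R"
        by (auto simp: conflict_def)
      have "u \<in> {Cyc i, Pend i 1, Pend i 2}"
        using uv(2,3) by (auto simp: mem_cycle_links mem_pendant_links mem_spider_links)
      \<comment> \<open>No leg starts at \<open>Cyc i\<close>, because \<open>i\<close> is even and
        the spider sits at \<open>Cyc 1\<close>.\<close>
      then show "p \<in> {p \<in> ?T. pendant_index p = i}"
        using uv(1) p i by (cases p) (auto simp: mem_cycle_links mem_pendant_links mem_spider_links)
    next
      have touch: "\<exists>u\<in>edge_of p. u \<in> {Cyc i, Pend i 1}" if "p \<in> {p \<in> ?T. pendant_index p = i}" for p
        using index[of p] that by auto
      fix p q assume "p \<in> {p \<in> ?T. pendant_index p = i}" "q \<in> {p \<in> ?T. pendant_index p = i}"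
      then obtain u v where uv: "u \<in> edge_of p" "v \<in> edge_of q" "u \<in> {Cyc i, Pend i 1}" "v \<in> {Cyc i, Pend i 1}"
        using touch by meson
      show "conflict ?R p q"
        unfolding conflict_def
        by (rule bexI[OF bexI[OF _ uv(2)] uv(1)]) (use uv(3,4) link(1) in blast)
    qed
  qed simp
  then show ?thesis by (simp add: Q_graph_links Un_ac)
qed

text \<open>Two edges of \<open>L\<^sub>r\<close> outside the outer parts of the legs can be in a common induced matching
  only if their codes are related: code \<open>i\<close> with \<open>1 \<le> i \<le> 7\<close> is the cycle edge leaving \<open>v\<^sub>i\<close>, code
  \<open>0\<close> are the edges from \<open>v\<^sub>1\<close> to the legs, code \<open>8\<close> is the pendant edge.\<close>

definition compatible :: "nat rel" where
  "compatible = {(0,3), (0,4), (0,5), (8,4), (8,5), (8,6), (1,4), (1,5), (2,5), (2,6), (3,6), (3,7), (4,7)}"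

text \<open>Three pairwise non-conflicting core edges would give a triangle of codes, so this bounds
  their number by two. The relation is finite and evaluation decides the claim.\<close>

lemma compatible_triangle_free:
  assumes "(a, b) \<in> compatible \<union> compatible\<inverse>" "(b, c) \<in> compatible \<union> compatible\<inverse>"
  shows "(a, c) \<notin> compatible \<union> compatible\<inverse>"
proof -
  have "\<forall>p\<in>compatible \<union> compatible\<inverse>. \<forall>q\<in>compatible \<union> compatible\<inverse>.
      snd p = fst q \<longrightarrow> (fst p, snd q) \<notin> compatible \<union> compatible\<inverse>"
    unfolding compatible_def by code_simp
  from bspec[OF bspec[OF this assms(1)] assms(2)] show ?thesis by simp
qed

fun core_code :: "vertex \<times> vertex \<Rightarrow> nat" where
  "core_code (Cyc i, Cyc j) = i"
| "core_code (_, Pend i j) = 8"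
| "core_code _ = 0"

text \<open>The first edge of a leg belongs to the core, since it does not conflict with the leaf
  edge of that leg.\<close>

definition L_core :: "nat \<Rightarrow> vertex rel" where
  "L_core r = cycle_links 7 \<union> {(Cyc 2, Pend 2 1)} \<union> (\<lambda>i. (Cyc 1, Leg i 1)) ` {..<r}"

definition L_links :: "nat \<Rightarrow> vertex rel" where
  "L_links r = cycle_links 7 \<union> spider_links (Cyc 1) r 3 \<union> {(Cyc 2, Pend 2 1)}"

lemma L_core_cases:
  assumes "p \<in> L_core r"
  obtains "p = (Cyc 1, Cyc 2)" | "p = (Cyc 2, Cyc 3)" | "p = (Cyc 3, Cyc 4)" | "p = (Cyc 4, Cyc 5)"
    | "p = (Cyc 5, Cyc 6)" | "p = (Cyc 6, Cyc 7)" | "p = (Cyc 7, Cyc 1)" | "p = (Cyc 2, Pend 2 1)"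
    | i where "i < r" "p = (Cyc 1, Leg i 1)"
  using assms by (auto simp: L_core_def cycle_links_7)

lemma mem_L_links:
  "(u, v) \<in> L_links r \<longleftrightarrow> (u, v) \<in> {(Cyc 1, Cyc 2), (Cyc 2, Cyc 3), (Cyc 3, Cyc 4), (Cyc 4, Cyc 5),
      (Cyc 5, Cyc 6), (Cyc 6, Cyc 7), (Cyc 7, Cyc 1), (Cyc 2, Pend 2 1)} \<or>
    (u, v) \<in> spider_links (Cyc 1) r 3"
  by (auto simp: L_links_def cycle_links_7)

lemma conflict_Pair:
  "conflict R (a, b) (c, d) \<longleftrightarrow> (\<exists>u\<in>{a, b}. \<exists>v\<in>{c, d}. u = v \<or> (u, v) \<in> R \<or> (v, u) \<in> R)"
  by (simp add: conflict_def)

text \<open>The leg number does not influence conflicts among core edges, so one code serves all leg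
  edges and nine by nine cases suffice.\<close>

lemma L_core_conflict:
  assumes "p \<in> L_core r" "q \<in> L_core r" "\<not> conflict (L_links r) p q"
  shows "(core_code p, core_code q) \<in> compatible \<union> compatible\<inverse>"
  using assms(3)
  by (cases rule: L_core_cases[OF assms(1)]; cases rule: L_core_cases[OF assms(2)])
    (simp_all add: conflict_Pair mem_L_links mem_spider_links compatible_def)

text \<open>Four core edges that avoid \<open>Cyc 1\<close>, used as probes: a maximal set must
  conflict with each of them inside the core.\<close>

definition L_inner :: "vertex rel" where
  "L_inner = {(Cyc 4, Cyc 5), (Cyc 5, Cyc 6), (Cyc 6, Cyc 7), (Cyc 2, Pend 2 1)}"

text \<open>Leg vertices are joined to the rest only through \<open>Cyc 1\<close>, which
  \<open>z\<close> avoids. Hence \<open>p\<close> has an endpoint off the legs, and every such edge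
  is in the core.\<close>

lemma L_inner_conflict:
  assumes "z \<in> L_inner" "p \<in> L_links r" "conflict (L_links r) z p"
  shows "p \<in> L_core r"
proof -
  obtain u v where uv: "v \<in> edge_of z" "u \<in> edge_of p" "v = u \<or> (v, u) \<in> L_links r \<or> (u, v) \<in> L_links r"
    using assms(3) by (auto simp: conflict_def)
  have "v \<in> {Cyc 2, Cyc 4, Cyc 5, Cyc 6, Cyc 7, Pend 2 1}"
    using uv(1) assms(1) by (auto simp: L_inner_def)
  then have u: "u \<noteq> Leg i j" for i j
    using uv(3) by (auto simp: mem_L_links mem_spider_links)
  show ?thesis
  proof (cases "p \<in> spider_links (Cyc 1) r 3")
    case True
    then show ?thesis
      using uv(2) u by (cases p) (auto simp: mem_spider_links L_core_def)
  next
    case False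
    then show ?thesis using assms(2) by (auto simp: L_links_def L_core_def)
  qed
qed

text \<open>The pendant edge is free of the edges leaving \<open>Cyc 4\<close>, \<open>Cyc 5\<close>
  and \<open>Cyc 6\<close>, and every other core edge is free of one of these three or of the
  pendant edge.\<close>

lemma L_inner_free:
  assumes "y \<in> L_core r"
  shows "\<exists>z\<in>L_inner. \<not> conflict (L_links r) z y"
  by (cases rule: L_core_cases[OF assms])
    (simp_all add: L_inner_def conflict_Pair mem_L_links mem_spider_links)

lemma card_inter_L_core:
  assumes A: "maximal_conflict_free (L_links r) A"
  shows "card (A \<inter> L_core r) = 2"
proof -
  have hit: "\<exists>q\<in>A \<inter> L_core r. conflict (L_links r) z q" if "z \<in> L_inner" for z
  proof (cases "z \<in> A")
    case True
    \<comment> \<open>Here \<open>z\<close> conflicts with itself.\<close>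
    then show ?thesis using that by (auto simp: L_inner_def L_core_def cycle_links_7 conflict_def)
  next
    case False
    moreover have "z \<in> L_links r" using that by (auto simp: L_inner_def mem_L_links)
    ultimately obtain q where "q \<in> A" "conflict (L_links r) z q"
      using A unfolding maximal_conflict_free_def by blast
    then show ?thesis
      using L_inner_conflict[OF that, of q r] A by (auto simp: maximal_conflict_free_def)
  qed
  \<comment> \<open>Any probe yields a first core edge \<open>p\<close>; a probe \<open>z\<close>
    free of \<open>p\<close> then forces a second one, \<open>q\<close>.\<close>
  obtain p where p: "p \<in> A \<inter> L_core r"
    using hit[of "(Cyc 4, Cyc 5)"] by (auto simp: L_inner_def)
  obtain z where z: "z \<in> L_inner" "\<not> conflict (L_links r) z p"
    using p L_inner_free[of p r] by blast
  obtain q where q: "q \<in> A \<inter> L_core r" "conflict (L_links r) z q"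
    using hit[OF z(1)] by blast
  have free: "(core_code a, core_code b) \<in> compatible \<union> compatible\<inverse>"
    if "a \<in> A \<inter> L_core r" "b \<in> A \<inter> L_core r" "a \<noteq> b" for a b
    using that A L_core_conflict[of a r b] by (auto simp: maximal_conflict_free_def)
  have "p \<noteq> q" using z(2) q(2) by blast
  \<comment> \<open>A third core edge would make three codes pairwise compatible.\<close>
  have "A \<inter> L_core r \<subseteq> {p, q}"
  proof
    fix x assume x: "x \<in> A \<inter> L_core r"
    show "x \<in> {p, q}"
    proof (rule ccontr)
      assume "x \<notin> {p, q}"
      then show False
        using compatible_triangle_free[OF free[OF p q(1) \<open>p \<noteq> q\<close>] free[OF q(1) x]] free[OF p x] by blast
    qed
  qed
  then have "A \<inter> L_core r = {p, q}" using p q(1) by blast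
  then show ?thesis using \<open>p \<noteq> q\<close> by simp
qed

text \<open>The leaf edge now reaches only \<open>Leg i 2\<close>; selecting by \<open>fst\<close>
  keeps the edge at \<open>Cyc 1\<close> out of the block.\<close>

lemma simplicial_block_long_leg:
  assumes "i < r"
  shows "simplicial_block (L_links r) (Leg i 3, Leg i 4) {p \<in> L_links r. \<exists>j. fst p = Leg i j}"
proof -
  let ?B = "{(Leg i 1, Leg i 2), (Leg i 2, Leg i 3), (Leg i 3, Leg i 4)}"
  have B: "{p \<in> L_links r. \<exists>j. fst p = Leg i j} = ?B"
  proof -
    have "p \<in> ?B" if p: "p \<in> L_links r" "fst p = Leg i j" for p j
    proof -
      have "j = 1 \<or> j = 2 \<or> j = 3" "snd p = Leg i (Suc j)"
        using p by (cases p, auto simp: mem_L_links mem_spider_links)+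
      then show ?thesis using p(2) by (cases p) auto
    qed
    moreover have "?B \<subseteq> L_links r"
      using assms by (auto simp: mem_L_links mem_spider_links)
    ultimately show ?thesis by auto
  qed
  have "simplicial_block (L_links r) (Leg i 3, Leg i 4) ?B"
    unfolding simplicial_block_def
  proof (intro conjI)
    show "?B \<subseteq> L_links r" using B by blast
    show "\<forall>p\<in>L_links r. conflict (L_links r) p (Leg i 3, Leg i 4) \<longrightarrow> p \<in> ?B"
    proof (intro ballI impI)
      fix p assume p: "p \<in> L_links r" and "conflict (L_links r) p (Leg i 3, Leg i 4)"
      then obtain u v where uv: "u \<in> edge_of p" "v \<in> {Leg i 3, Leg i 4}"
          "u = v \<or> (u, v) \<in> L_links r \<or> (v, u) \<in> L_links r"
        by (auto simp: conflict_def)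
      \<comment> \<open>The bound on \<open>j\<close> excludes the edge from \<open>Cyc 1\<close> to
        \<open>Leg i 1\<close>.\<close>
      have "\<exists>j\<ge>2. u = Leg i j"
        using uv(2,3) by (auto simp: mem_L_links mem_spider_links)
      then have "\<exists>j. fst p = Leg i j"
        using uv(1) p by (cases p) (auto simp: mem_L_links mem_spider_links)
      then show "p \<in> ?B" using p B by blast
    qed
    show "\<forall>p\<in>?B. \<forall>q\<in>?B. conflict (L_links r) p q"
      using assms by (simp add: conflict_Pair mem_L_links mem_spider_links)
  qed simp
  then show ?thesis using B by simp
qed

lemma well_indumatched_L: "well_indumatched (L_graph r)"
proof -
  \<comment> \<open>\<open>None\<close> labels the core, which contributes two edges, and
    \<open>Some i\<close> the outer part of leg \<open>i\<close>, which contributes one.\<close>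
  define lab where "lab p = (case fst p of Leg i j \<Rightarrow> Some i | _ \<Rightarrow> None)" for p :: "vertex \<times> vertex"
  have lab_Some: "lab p = Some i \<longleftrightarrow> (\<exists>j. fst p = Leg i j)" for p i
    by (auto simp: lab_def split: vertex.split)
  have R: "finite (L_links r)" "L_links r \<inter> (L_links r)\<inverse> = {}"
    by (auto simp: L_links_def finite_spider_links finite_cycle_links mem_spider_links mem_cycle_links)
  have core: "lab p = None \<longleftrightarrow> p \<in> L_core r" if "p \<in> L_links r" for p
    using that by (cases p) (auto simp: lab_def mem_L_links mem_spider_links L_core_def cycle_links_7)
  have range: "lab p \<in> insert None (Some ` {..<r})" if "p \<in> L_links r" for p
    using that by (cases p) (auto simp: lab_def mem_L_links mem_spider_links)
  have "card A = 2 + r" if A: "maximal_conflict_free (L_links r) A" for A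
  proof -
    have sub: "A \<subseteq> L_links r" using A by (simp add: maximal_conflict_free_def)
    have "{p \<in> A. lab p = None} = A \<inter> L_core r" using sub core by blast
    then have none: "card {p \<in> A. lab p = None} = 2" using card_inter_L_core[OF A] by simp
    have some: "card {p \<in> A. lab p = Some i} = 1" if "i < r" for i
    proof -
      have "{p \<in> A. lab p = Some i} = A \<inter> {p \<in> L_links r. \<exists>j. fst p = Leg i j}"
        using sub lab_Some by blast
      then show ?thesis
        using card_inter_simplicial_block[OF A simplicial_block_long_leg[OF that]] by simp
    qed
    have "card A = (\<Sum>x\<in>insert None (Some ` {..<r}). card {p \<in> A. lab p = x})"
      using finite_subset[OF sub R(1)] sub range by (intro card_eq_sum_blocks) auto
    also have "\<dots> = 2 + (\<Sum>i<r. card {p \<in> A. lab p = Some i})"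
      using none by (subst sum.insert) (auto simp: sum.reindex)
    also have "\<dots> = 2 + r" using some by simp
    finally show ?thesis .
  qed
  then have "well_indumatched (graph_of (L_links r))"
    by (rule well_indumatched_graph_ofI[OF R])
  then show ?thesis by (simp add: L_graph_def L_links_def)
qed

section \<open>Infinite families\<close>

lemma Leg_in_spider_graph:
  assumes "spider_links c r k \<subseteq> R"
  shows "(\<lambda>i. Leg i 1) ` {..<r} \<subseteq> pverts (graph_of R)"
proof -
  have "(c, Leg i 1) \<in> R" if "i < r" for i
    using assms that by (auto simp: spider_links_def)
  then show ?thesis
    by (auto simp: graph_of_def intro: FieldI2)
qed

text \<open>All three properties survive relabelling, and the legs make the vertex numbers
  unbounded.\<close>

lemma infinite_unicyclic:
  fixes g :: "nat \<Rightarrow> vertex pair_pre_digraph"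
  assumes "\<And>r. 1 \<le> r \<Longrightarrow> well_indumatched (g r) \<and> unicyclic (g r) \<and> girth (g r) = enat k"
    and "\<And>r. (\<lambda>i. Leg i 1) ` {..<r} \<subseteq> pverts (g r)"
  shows "infinite ({G :: nat pair_pre_digraph. well_indumatched G \<and> unicyclic G \<and> girth G = enat k}
    // graph_iso_rel)"
proof (rule infinite_quotient_relabelled_family[where g = g])
  fix r :: nat assume "1 \<le> r"
  then show "relabel to_nat (g r) \<in> {G. well_indumatched G \<and> unicyclic G \<and> girth G = enat k}"
    using assms(1) by (simp add: well_indumatched_relabel unicyclic_relabel girth_relabel)
qed (use assms(2) in \<open>auto simp: unicyclic_def\<close>)

lemma infinite_trees:
  "infinite ({G :: nat pair_pre_digraph. well_indumatched G \<and> undirected_tree G} // graph_iso_rel)"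
proof (rule infinite_quotient_relabelled_family[where g = "\<lambda>r. S_graph r 2"])
  fix r :: nat assume "1 \<le> r"
  then show "relabel to_nat (S_graph r 2) \<in> {G. well_indumatched G \<and> undirected_tree G}"
    by (simp add: well_indumatched_relabel undirected_tree_relabel well_indumatched_S undirected_tree_S)
next
  show "(\<lambda>i. Leg i 1) ` {..<r} \<subseteq> pverts (S_graph r 2)" for r
    unfolding S_graph_def by (rule Leg_in_spider_graph) (rule subset_refl)
qed (auto simp: undirected_tree_def)

theorem theorem4p7:
  shows "(\<forall>r::nat. r \<ge> 1 \<longrightarrow>
      (well_indumatched (S_graph r 2) \<and> undirected_tree (S_graph r 2)) \<and>
      (well_indumatched (G_graph r) \<and> unicyclic (G_graph r) \<and> girth (G_graph r) = 3) \<and>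
      (well_indumatched (H_graph r) \<and> unicyclic (H_graph r) \<and> girth (H_graph r) = 5) \<and>
      (well_indumatched (L_graph r) \<and> unicyclic (L_graph r) \<and> girth (L_graph r) = 7) \<and>
      (\<forall>k::nat. even k \<and> k \<ge> 4 \<longrightarrow>
        well_indumatched (Q_graph k r) \<and> unicyclic (Q_graph k r) \<and> girth (Q_graph k r) = enat k)) \<and>
    infinite ({G :: nat pair_pre_digraph. well_indumatched G \<and> undirected_tree G} // graph_iso_rel) \<and>
    (\<forall>k::nat. k \<in> {3, 5, 7} \<or> (even k \<and> k > 2) \<longrightarrow>
      infinite ({G :: nat pair_pre_digraph. well_indumatched G \<and> unicyclic G \<and> girth G = enat k}
        // graph_iso_rel))"
proof (intro conjI allI impI)
  fix r :: nat assume r: "1 \<le> r"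
  show "well_indumatched (S_graph r 2)" "undirected_tree (S_graph r 2)"
    using r by (simp_all add: well_indumatched_S undirected_tree_S)
  show "well_indumatched (G_graph r)" "unicyclic (G_graph r)" "girth (G_graph r) = 3"
    by (simp_all add: well_indumatched_G unicyclic_G)
  show "well_indumatched (H_graph r)" "unicyclic (H_graph r)" "girth (H_graph r) = 5"
    by (simp_all add: well_indumatched_H unicyclic_H)
  show "well_indumatched (L_graph r)" "unicyclic (L_graph r)" "girth (L_graph r) = 7"
    by (simp_all add: well_indumatched_L unicyclic_L)
  fix k :: nat assume "even k \<and> 4 \<le> k"
  then show "well_indumatched (Q_graph k r)" "unicyclic (Q_graph k r)" "girth (Q_graph k r) = enat k"
    by (simp_all add: well_indumatched_Q unicyclic_Q)
next
  show "infinite ({G :: nat pair_pre_digraph. well_indumatched G \<and> undirected_tree G} // graph_iso_rel)"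
    by (rule infinite_trees)
next
  fix k :: nat assume "k \<in> {3, 5, 7} \<or> even k \<and> 2 < k"
  moreover have "4 \<le> k" if "even k" "2 < k"
    using that by presburger
  ultimately consider "k = 3" | "k = 5" | "k = 7" | "even k" "4 \<le> k"
    by blast
  then show "infinite ({G :: nat pair_pre_digraph. well_indumatched G \<and> unicyclic G \<and> girth G = enat k}
      // graph_iso_rel)"
  proof cases
    case 1
    show ?thesis
    proof (rule infinite_unicyclic[where g = G_graph])
      show "(\<lambda>i. Leg i 1) ` {..<r} \<subseteq> pverts (G_graph r)" for r
        unfolding G_graph_def by (rule Leg_in_spider_graph[of Center r 2]) blast
    qed (simp add: 1 well_indumatched_G unicyclic_G numeral_eq_enat)
  next
    case 2
    show ?thesis
    proof (rule infinite_unicyclic[where g = H_graph])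
      show "(\<lambda>i. Leg i 1) ` {..<r} \<subseteq> pverts (H_graph r)" for r
        unfolding H_graph_def by (rule Leg_in_spider_graph[of "Cyc 1" r 2]) blast
    qed (simp add: 2 well_indumatched_H unicyclic_H numeral_eq_enat)
  next
    case 3
    show ?thesis
    proof (rule infinite_unicyclic[where g = L_graph])
      show "(\<lambda>i. Leg i 1) ` {..<r} \<subseteq> pverts (L_graph r)" for r
        unfolding L_graph_def by (rule Leg_in_spider_graph[of "Cyc 1" r 3]) blast
    qed (simp add: 3 well_indumatched_L unicyclic_L numeral_eq_enat)
  next
    case 4
    show ?thesis
    proof (rule infinite_unicyclic[where g = "Q_graph k"])
      show "(\<lambda>i. Leg i 1) ` {..<r} \<subseteq> pverts (Q_graph k r)" for r
        unfolding Q_graph_links by (rule Leg_in_spider_graph[of "Cyc 1" r 2]) blast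
    qed (simp add: 4 well_indumatched_Q unicyclic_Q)
  qed
qed

end
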